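(* Assume the standing setting below, and assume in addition that for some integer $j\ge2$ one has $D(A_2^{j/2})\subset D(A_1)$ and $|A_1u|\le c|A_2^{j/2}u|$ for all $u\in D(A_2^{j/2})$, for some $c>0$. Let $0<\theta<1$ and let $n\ge1$ be an integer. Then there is $c_{n,\theta}>0$ such that for every $U_0\in(\mathcal H,D(\mathcal A^{nj}))_{\theta,2}$ the solution $U(t)=e^{t\mathcal A}U_0$ satisfies $$\|U(t)\|^2_{\mathcal H}\le\frac{c_{n,\theta}}{t^{n\theta}}\|U_0\|^2_{(\mathcal H,D(\mathcal A^{nj}))_{\theta,2}}\qquad\forall t>0.$$
   Context: Standing setting: $H$ is a real Hilbert space with inner product $\langle\cdot,\cdot\rangle$ and norm $|\cdot|$. $A_1,A_2$ are densely defined closed self-adjoint operators on $H$ with $\langle A_iu,u\rangle\ge\omega_i|u|^2$ for $u\in D(A_i)$, for some $\omega_1,\omega_2>0$; $A_i^{s}$ denote their fractional powers. $B$ is a bounded self-adjoint operator on $H$ with $\langle Bu,u\rangle\ge\beta|u|^2$ for all $u\in H$, for some $\beta>0$. $\alpha\in\mathbb R$ satisfies $0<|\alpha|<\sqrt{\omega_1\omega_2}$. Let $\mathcal H=D(A_1^{1/2})\times H\times D(A_2^{1/2})\times H$ with the inner product $(U|\widehat U)=\langle A_1^{1/2}u,A_1^{1/2}\widehat u\rangle+\langle p,\widehat p\rangle+\langle A_2^{1/2}v,A_2^{1/2}\widehat v\rangle+\langle q,\widehat q\rangle+\alpha\langle u,\widehat v\rangle+\alpha\langle v,\widehat u\rangle$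 for $U=(u,p,v,q)$, norm $\|U\|_{\mathcal H}=(U|U)^{1/2}$. Define $\mathcal A$ on $D(\mathcal A)=D(A_1)\times D(A_1^{1/2})\times D(A_2)\times D(A_2^{1/2})$ by $\mathcal AU=(p,-A_1u-Bp-\alpha v,q,-A_2v-\alpha u)$; it generates a $C_0$-semigroup of contractions $e^{t\mathcal A}$ on $\mathcal H$, corresponding to the system $u''+A_1u+Bu'+\alpha v=0$, $v''+A_2v+\alpha u=0$. $D(\mathcal A^k)$ carries its graph norm. Real interpolation: for Banach spaces $D\hookrightarrow X$, $K(t,x)=\inf\{|a|_X+t|b|_D: x=a+b,\ a\in X,\ b\in D\}$ and $(X,D)_{\theta,2}=\{x\in X:\int_0^\infty (t^{-\theta-1/2}K(t,x))^2dt<\infty\}$ with norm the square root of that integral. *)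

theory Defs
  imports "HOL-Analysis.Analysis"
begin

text \<open>An (unbounded) operator is a pair: a domain D and a map A (values outside D irrelevant).\<close>

definition linear_on_dom :: "'a::real_vector set \<Rightarrow> ('a \<Rightarrow> 'a) \<Rightarrow> bool" where
  "linear_on_dom D A \<longleftrightarrow> subspace D \<and>
     (\<forall>x\<in>D. \<forall>y\<in>D. A (x + y) = A x + A y) \<and> (\<forall>x\<in>D. \<forall>r. A (r *\<^sub>R x) = r *\<^sub>R A x)"

definition selfadjoint_op :: "'a::{real_inner,complete_space} set \<Rightarrow> ('a \<Rightarrow> 'a) \<Rightarrow> bool" where
  "selfadjoint_op D A \<longleftrightarrow> linear_on_dom D A \<and> closure D = UNIV \<and>
     closed {(x, A x) | x. x \<in> D} \<and>
     (\<forall>x\<in>D. \<forall>y\<in>D. inner (A x) y = inner x (A y)) \<and>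
     (\<forall>y. (\<exists>z. \<forall>x\<in>D. inner (A x) y = inner x z) \<longrightarrow> y \<in> D)"

definition is_pos_sqrt :: "'a::{real_inner,complete_space} set \<Rightarrow> ('a \<Rightarrow> 'a) \<Rightarrow> 'a set \<Rightarrow> ('a \<Rightarrow> 'a) \<Rightarrow> bool" where
  "is_pos_sqrt D A DS S \<longleftrightarrow> selfadjoint_op DS S \<and> (\<forall>x\<in>DS. inner (S x) x \<ge> 0) \<and>
     D = {x \<in> DS. S x \<in> DS} \<and> (\<forall>x\<in>D. S (S x) = A x)"

text \<open>Domain of the k-th power of an operator (D,S); the power acts as S^^k.
  With S = A^(1/2), (op_dom DS S k, S^^k) is A^(k/2).\<close>
fun op_dom :: "'a set \<Rightarrow> ('a \<Rightarrow> 'a) \<Rightarrow> nat \<Rightarrow> 'a set" where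
  "op_dom D S 0 = UNIV"
| "op_dom D S (Suc k) = {x \<in> D. S x \<in> op_dom D S k}"

type_synonym 'a state = "'a \<times> 'a \<times> 'a \<times> 'a"

definition Hspace :: "'a set \<Rightarrow> 'a set \<Rightarrow> 'a state set" where
  "Hspace DS1 DS2 = DS1 \<times> UNIV \<times> DS2 \<times> UNIV"

definition Hinner :: "('a::real_inner \<Rightarrow> 'a) \<Rightarrow> ('a \<Rightarrow> 'a) \<Rightarrow> real \<Rightarrow> 'a state \<Rightarrow> 'a state \<Rightarrow> real" where
  "Hinner S1 S2 \<alpha> U V = (case U of (u,p,v,q) \<Rightarrow> case V of (u',p',v',q') \<Rightarrow>
     inner (S1 u) (S1 u') + inner p p' + inner (S2 v) (S2 v') + inner q q'
     + \<alpha> * inner u v' + \<alpha> * inner v u')"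

definition Hnorm :: "('a::real_inner \<Rightarrow> 'a) \<Rightarrow> ('a \<Rightarrow> 'a) \<Rightarrow> real \<Rightarrow> 'a state \<Rightarrow> real" where
  "Hnorm S1 S2 \<alpha> U = sqrt (Hinner S1 S2 \<alpha> U U)"

definition calA_dom :: "'a set \<Rightarrow> 'a set \<Rightarrow> 'a set \<Rightarrow> 'a set \<Rightarrow> 'a state set" where
  "calA_dom D1 DS1 D2 DS2 = D1 \<times> DS1 \<times> D2 \<times> DS2"

definition calA :: "('a::real_vector \<Rightarrow> 'a) \<Rightarrow> ('a \<Rightarrow> 'a) \<Rightarrow> ('a \<Rightarrow> 'a) \<Rightarrow> real \<Rightarrow> 'a state \<Rightarrow> 'a state" where
  "calA A1 A2 B \<alpha> U = (case U of (u,p,v,q) \<Rightarrow>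
     (p, - A1 u - B p - \<alpha> *\<^sub>R v, q, - A2 v - \<alpha> *\<^sub>R u))"

definition is_C0_semigroup_generated ::
  "'b::real_vector set \<Rightarrow> ('b \<Rightarrow> real) \<Rightarrow> (real \<Rightarrow> 'b \<Rightarrow> 'b) \<Rightarrow> 'b set \<Rightarrow> ('b \<Rightarrow> 'b) \<Rightarrow> bool" where
  "is_C0_semigroup_generated X nrm T DA G \<longleftrightarrow>
     (\<forall>t\<ge>0. \<forall>U\<in>X. T t U \<in> X) \<and>
     (\<forall>U\<in>X. T 0 U = U) \<and>
     (\<forall>t s. t \<ge> 0 \<longrightarrow> s \<ge> 0 \<longrightarrow> (\<forall>U\<in>X. T (t + s) U = T t (T s U))) \<and>
     (\<forall>t\<ge>0. (\<forall>U\<in>X. \<forall>V\<in>X. T t (U + V) = T t U + T t V) \<and>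
             (\<forall>U\<in>X. \<forall>r. T t (r *\<^sub>R U) = r *\<^sub>R T t U) \<and>
             (\<exists>M. \<forall>U\<in>X. nrm (T t U) \<le> M * nrm U)) \<and>
     (\<forall>U\<in>X. ((\<lambda>t. nrm (T t U - U)) \<longlongrightarrow> 0) (at_right 0)) \<and>
     DA \<subseteq> X \<and>
     (\<forall>U\<in>X. U \<in> DA \<longleftrightarrow>
        (\<exists>V\<in>X. ((\<lambda>h. nrm ((1 / h) *\<^sub>R (T h U - U) - V)) \<longlongrightarrow> 0) (at_right 0))) \<and>
     (\<forall>U\<in>DA. G U \<in> X \<and> ((\<lambda>h. nrm ((1 / h) *\<^sub>R (T h U - U) - G U)) \<longlongrightarrow> 0) (at_right 0))"

fun gen_dom :: "'b set \<Rightarrow> 'b set \<Rightarrow> ('b \<Rightarrow> 'b) \<Rightarrow> nat \<Rightarrow> 'b set" where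
  "gen_dom X DA G 0 = X"
| "gen_dom X DA G (Suc k) = {U \<in> DA. G U \<in> gen_dom X DA G k}"

definition graph_norm :: "('b \<Rightarrow> real) \<Rightarrow> ('b \<Rightarrow> 'b) \<Rightarrow> nat \<Rightarrow> 'b \<Rightarrow> real" where
  "graph_norm nrm G k U = (\<Sum>i\<le>k. nrm ((G ^^ i) U))"

definition Kfun :: "'b::real_vector set \<Rightarrow> ('b \<Rightarrow> real) \<Rightarrow> 'b set \<Rightarrow> ('b \<Rightarrow> real) \<Rightarrow> real \<Rightarrow> 'b \<Rightarrow> real" where
  "Kfun X nX D nD t x = Inf {nX a + t * nD b | a b. x = a + b \<and> a \<in> X \<and> b \<in> D}"

definition interp_integral ::
  "'b::real_vector set \<Rightarrow> ('b \<Rightarrow> real) \<Rightarrow> 'b set \<Rightarrow> ('b \<Rightarrow> real) \<Rightarrow> real \<Rightarrow> 'b \<Rightarrow> ennreal" where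
  "interp_integral X nX D nD \<theta> x =
     (\<integral>\<^sup>+ t. ennreal ((t powr (- \<theta> - 1/2) * Kfun X nX D nD t x)\<^sup>2) * indicator {0<..} t \<partial>lborel)"

definition interp_space :: "'b::real_vector set \<Rightarrow> ('b \<Rightarrow> real) \<Rightarrow> 'b set \<Rightarrow> ('b \<Rightarrow> real) \<Rightarrow> real \<Rightarrow> 'b set" where
  "interp_space X nX D nD \<theta> = {x \<in> X. interp_integral X nX D nD \<theta> x < \<infinity>}"

definition interp_norm :: "'b::real_vector set \<Rightarrow> ('b \<Rightarrow> real) \<Rightarrow> 'b set \<Rightarrow> ('b \<Rightarrow> real) \<Rightarrow> real \<Rightarrow> 'b \<Rightarrow> real" where
  "interp_norm X nX D nD \<theta> x = sqrt (enn2real (interp_integral X nX D nD \<theta> x))"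

end

theory Submission
  imports Defs
begin

text \<open>
  Conjugating by \<open>(u,p,v,q) \<mapsto> (A1\<^bsup>1/2\<^esup> u, p, A2\<^bsup>1/2\<^esup> v, q)\<close> turns the energy space into the Hilbert space \<open>'a\<^sup>4\<close>,
  on which the generator has a bounded inverse \<open>G\<close>; so \<open>U0 = G\<^sup>N y\<close> and the time derivatives of the
  solution are \<open>G\<^sup>m\<close> applied to the trajectory of \<open>y\<close>. The damping controls the time integrals of
  \<open>|u'|\<^sup>2, \<dots>, |u\<^bsup>(j+1)\<^esup>|\<^sup>2\<close> by the energies of the derivatives of the initial data. Equipartition for
  \<open>A2\<^bsup>-k/2\<^esup> v\<^bsup>(k+1)\<^esup>\<close> bounds the integral of \<open>|v'|\<^sup>2\<close> by that of \<open>|A2\<^bsup>-j/2\<^esup> v\<^bsup>(j+1)\<^esup>|\<^sup>2\<close>, and the latter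
  is read off the first equation paired with \<open>A2\<^bsup>-j\<^esup> v\<^bsup>(j+1)\<^esup>\<close>, since \<open>A1 A2\<^bsup>-j/2\<^esup>\<close> is bounded. All these
  identities add up to a Lyapunov functional, so the energy is integrable; being nonincreasing, it
  decays like \<open>1/t\<close> on \<open>D(\<A>\<^sup>j)\<close>, hence like \<open>1/t\<^sup>n\<close> on \<open>D(\<A>\<^bsup>nj\<^esup>)\<close>. Splitting \<open>U0 = a + b\<close> and using
  contractivity on \<open>a\<close> bounds \<open>\<parallel>U(t)\<parallel>\<close> by the \<open>K\<close>-functional at \<open>t\<^bsup>-n/2\<^esup>\<close>.
\<close>

text \<open>Only \<open>u\<close> is damped, so the dissipation does not see \<open>v\<close>. The
  first equation does contain \<alpha> v, but next to A1 u, which the damping does not control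
  either. Pairing with A2^(-j) v^(j+1) resolves this: A1 moves onto A2^(-j/2), where it is bounded,
  and the price is a loss of j powers of A2^(1/2). Equipartition then pays each lost power back with
  one time derivative, which is why exactly j derivatives of the data are required.

  The energy space is a set with a norm of its own, whereas the conjugated problem lives on a
  product type on which every map is bounded and total. Domain conditions thereby disappear: lying
  in the domain of a power becomes having the form \<open>(G ^^ k) w\<close>.

  The argument of the K-functional is t^(-n/2) because the decay t^(-n) concerns the squared norm. A
  single value of the K-functional at s costs at most a multiple of s^\<theta> times the
  interpolation norm, which gives t^(-n \<theta>) after squaring.\<close>

section \<open>Strongly continuous semigroups\<close>

text \<open>Supplies the uniformity in \<open>t\<close> that the semigroup hypotheses lack, since
  they bound each \<open>T t\<close> separately. By Baire some \<open>V n\<close> contains a ball,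
  and differences of its points bound every \<open>f\<close> on a ball around 0.\<close>

lemma banach_steinhaus:
  fixes F :: "('b::{real_normed_vector,complete_space} \<Rightarrow> 'c::real_normed_vector) set"
  assumes lin: "\<And>f. f \<in> F \<Longrightarrow> bounded_linear f"
    and ptw: "\<And>x. \<exists>c. \<forall>f\<in>F. norm (f x) \<le> c"
  shows "\<exists>M\<ge>0. \<forall>f\<in>F. \<forall>x. norm (f x) \<le> M * norm x"
proof -
  define V where "V n = {x. \<forall>f\<in>F. norm (f x) \<le> real n}" for n :: nat
  have closedV: "closed (V n)" for n
  proof -
    have "V n = (\<Inter>f\<in>F. {x. norm (f x) \<le> real n})" by (auto simp: V_def)
    moreover have "closed {x. norm (f x) \<le> real n}" if "f \<in> F" for f
      using lin[OF that]
      by (intro closed_Collect_le continuous_intros linear_continuous_on) auto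
    ultimately show ?thesis by auto
  qed
  have cover: "(\<Union>n. V n) = UNIV"
  proof (intro equalityI subsetI)
    fix x
    obtain c where "\<forall>f\<in>F. norm (f x) \<le> c" using ptw by blast
    moreover obtain n where "c \<le> real n" using real_arch_simple by blast
    ultimately have "x \<in> V n" unfolding V_def by force
    then show "x \<in> (\<Union>n. V n)" by blast
  qed simp
  have "\<exists>n. interior (V n) \<noteq> {}"
  proof (rule ccontr)
    assume "\<not> ?thesis"
    then have "interior (\<Union>(range V)) = {}"
      using Met_TC.metric_Baire_category_alt[where 'a='b and \<G>="range V"] closedV
      by (auto simp: complete_UNIV)
    then show False using cover by simp
  qed
  then obtain n x r where r: "r > 0" "ball x r \<subseteq> V n"
    by (metis all_not_in_conv mem_interior)
  have small: "norm (f v) \<le> 2 * real n" if "f \<in> F" "norm v < r" for f v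
  proof -
    interpret bounded_linear f using lin that by blast
    have "x + v \<in> V n" "x \<in> V n" using r that by (auto simp: dist_norm subset_iff)
    then have "norm (f (x + v)) \<le> n" "norm (f x) \<le> n" using that by (auto simp: V_def)
    moreover have "f v = f (x + v) - f x" by (simp add: add)
    ultimately show ?thesis using norm_triangle_ineq4[of "f (x + v)" "f x"] by simp
  qed
  have "norm (f v) \<le> 4 * real n / r * norm v" if "f \<in> F" for f v
  proof (cases "v = 0")
    case False
    interpret bounded_linear f using lin that by blast
    have "norm (f ((r / (2 * norm v)) *\<^sub>R v)) \<le> 2 * real n"
      using r False by (intro small that) simp
    then show ?thesis using r False by (simp add: scaleR field_simps)
  next
    case True
    interpret bounded_linear f using lin that by blast
    show ?thesis using True by (simp add: zero)
  qed
  then show ?thesis using r by (intro exI[of _ "4 * real n / r"]) auto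
qed

text \<open>The generator enters only through its inverse \<open>G\<close>, so domains of its powers are ranges of
  powers of \<open>G\<close>.\<close>

locale c0_semigroup =
  fixes T :: "real \<Rightarrow> 'b::{real_normed_vector,complete_space} \<Rightarrow> 'b" and G :: "'b \<Rightarrow> 'b"
  assumes bounded_linear_T: "t \<ge> 0 \<Longrightarrow> bounded_linear (T t)"
    and T_zero: "T 0 x = x"
    and T_add: "t \<ge> 0 \<Longrightarrow> s \<ge> 0 \<Longrightarrow> T (t + s) x = T t (T s x)"
    and T_continuous_zero: "((\<lambda>t. norm (T t x - x)) \<longlongrightarrow> 0) (at_right 0)"
    and generator_iff:
      "((\<lambda>h. norm ((1 / h) *\<^sub>R (T h x - x) - y)) \<longlongrightarrow> 0) (at_right 0) \<longleftrightarrow> x = G y"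
begin

lemma T_near_zero:
  assumes "e > 0"
  shows "\<exists>d>0. \<forall>h. 0 \<le> h \<and> h < d \<longrightarrow> norm (T h x - x) < e"
proof -
  obtain d where d: "d > 0" "\<forall>h>0. h < d \<longrightarrow> norm (T h x - x) < e"
    using order_tendstoD(2)[OF T_continuous_zero assms, of x]
    by (auto simp: eventually_at_right_field)
  then have "norm (T h x - x) < e" if "0 \<le> h" "h < d" for h
    using that assms by (cases "h = 0") (auto simp: T_zero)
  then show ?thesis using d by blast
qed

text \<open>Otherwise there are times \<open>t n\<close> tending to 0 at which the operator norms
  exceed \<open>n + 1\<close>. Since \<open>T (t n) x\<close> tends to \<open>x\<close>, these
  operators are pointwise bounded, which contradicts uniform boundedness.\<close>

lemma T_bounded_near_zero:
  "\<exists>d>0. \<exists>M\<ge>1. \<forall>t\<in>{0..d}. \<forall>x. norm (T t x) \<le> M * norm x"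
proof (rule ccontr)
  assume "\<not> ?thesis"
  then have neg: "\<exists>t\<in>{0..d}. \<exists>x. norm (T t x) > M * norm x" if "d > 0" "M \<ge> 1" for d M
    using that by (meson linorder_not_le)
  have "\<forall>n. \<exists>t. t \<in> {0..1 / (real n + 1)} \<and> (\<exists>x. norm (T t x) > (real n + 1) * norm x)"
    using neg[of "1 / (real n + 1)" "real n + 1" for n] by force
  then obtain t where t: "\<And>n. t n \<in> {0..1 / (real n + 1)}"
      "\<And>n. \<exists>x. norm (T (t n) x) > (real n + 1) * norm x" by metis
  have "\<exists>M\<ge>0. \<forall>f\<in>range (\<lambda>n. T (t n)). \<forall>x. norm (f x) \<le> M * norm x"
  proof (rule banach_steinhaus)
    show "bounded_linear f" if "f \<in> range (\<lambda>n. T (t n))" for f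
      using that t by (auto intro: bounded_linear_T)
    show "\<exists>c. \<forall>f\<in>range (\<lambda>n. T (t n)). norm (f x) \<le> c" for x
    proof -
      obtain d where d: "d > 0" "\<And>h. 0 \<le> h \<Longrightarrow> h < d \<Longrightarrow> norm (T h x - x) < 1"
        using T_near_zero[of 1 x] by auto
      obtain N :: nat where N: "1 / d < real N" using reals_Archimedean2 by blast
      define c where "c = (\<Sum>n<N. norm (T (t n) x)) + norm x + 1"
      have "norm (T (t n) x) \<le> c" for n
      proof (cases "n < N")
        case True
        then have "norm (T (t n) x) \<le> (\<Sum>n<N. norm (T (t n) x))"
          by (intro member_le_sum) auto
        then show ?thesis unfolding c_def using norm_ge_zero[of x] by linarith
      next
        case False
        then have "1 / d < real n + 1" using N by linarith
        then have "1 / (real n + 1) < d" using d(1) by (simp add: field_simps)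
        then have "norm (T (t n) x - x) < 1" using t(1)[of n] by (intro d) auto
        moreover have "(\<Sum>n<N. norm (T (t n) x)) \<ge> 0" by (simp add: sum_nonneg)
        ultimately show ?thesis
          unfolding c_def using norm_triangle_sub[of "T (t n) x" x] by linarith
      qed
      then show ?thesis by blast
    qed
  qed
  then obtain M where M: "\<And>n x. norm (T (t n) x) \<le> M * norm x" by blast
  obtain n :: nat where "M < real n" using reals_Archimedean2 by blast
  then have "M * norm x \<le> (real n + 1) * norm x" for x :: 'b by (intro mult_right_mono) auto
  then show False using t(2)[of n] M[of n] by (meson leD order.trans)
qed

lemma T_locally_bounded:
  "\<exists>M\<ge>1. \<forall>t\<in>{0..a}. \<forall>x. norm (T t x) \<le> M * norm x"
proof -
  obtain d M where d: "d > 0" and M: "M \<ge> 1"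
      "\<And>t x. t \<in> {0..d} \<Longrightarrow> norm (T t x) \<le> M * norm x"
    using T_bounded_near_zero by blast
  have pow: "\<forall>t\<in>{0..real k * d}. \<forall>x. norm (T t x) \<le> M ^ k * norm x" for k
  proof (induction k)
    case 0
    then show ?case by (simp add: T_zero)
  next
    case (Suc k)
    show ?case
    proof (intro ballI allI)
      fix t x assume t: "t \<in> {0..real (Suc k) * d}"
      show "norm (T t x) \<le> M ^ Suc k * norm x"
      proof (cases "t \<le> d")
        case True
        then have "norm (T t x) \<le> M * norm x" using t M by auto
        also have "\<dots> \<le> M ^ Suc k * norm x"
          using M(1) self_le_power[of M "Suc k"] by (intro mult_right_mono) auto
        finally show ?thesis .
      next
        case False
        have "T t x = T d (T (t - d) x)" using T_add[of d "t - d" x] False d by simp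
        also have "norm \<dots> \<le> M * norm (T (t - d) x)" using d M by auto
        also have "\<dots> \<le> M * (M ^ k * norm x)"
          using t False M(1) by (intro mult_left_mono Suc.IH[rule_format]) (auto simp: algebra_simps)
        finally show ?thesis by (simp add: mult.assoc)
      qed
    qed
  qed
  obtain k :: nat where "a / d < real k" using reals_Archimedean2 by blast
  then have "a \<le> real k * d" using d by (simp add: field_simps)
  then show ?thesis using pow[of k] M(1) by (intro exI[of _ "M ^ k"]) (auto simp: one_le_power)
qed

text \<open>Factoring out the operator at the smaller time reduces continuity at \<open>t\<close>,
  from either side, to continuity at 0. From the left that operator varies, so a uniform
  \<open>M\<close> is essential.\<close>

lemma T_diff_le:
  assumes M: "\<And>t x. t \<in> {0..a} \<Longrightarrow> norm (T t x) \<le> M * norm x"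
    and "t \<in> {0..a}" "s \<in> {0..a}"
  shows "norm (T s x - T t x) \<le> M * norm (T \<bar>s - t\<bar> x - x)"
proof -
  have *: "norm (T v x - T u x) \<le> M * norm (T (v - u) x - x)" if "u \<in> {0..a}" "u \<le> v" for u v
  proof -
    interpret bounded_linear "T u" using that bounded_linear_T by auto
    have "T v x - T u x = T u (T (v - u) x - x)" using that T_add[of u "v - u" x] by (simp add: diff)
    then show ?thesis using M that by auto
  qed
  show ?thesis
    using *[of t s] *[of s t] assms(2,3) by (cases "t \<le> s") (auto simp: norm_minus_commute)
qed

lemma continuous_on_T: "continuous_on {0..} (\<lambda>t. T t x)"
  unfolding continuous_on_iff
proof (intro ballI allI impI)
  fix t e :: real assume t: "t \<in> {0..}" and e: "e > 0"
  obtain M where M: "M \<ge> 1" "\<And>s x. s \<in> {0..t + 1} \<Longrightarrow> norm (T s x) \<le> M * norm x"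
    using T_locally_bounded[of "t + 1"] by blast
  obtain d where d: "d > 0" "\<And>h. 0 \<le> h \<Longrightarrow> h < d \<Longrightarrow> norm (T h x - x) < e / M"
    using T_near_zero[of "e / M" x] e M(1) by auto
  have "dist (T s x) (T t x) < e" if "s \<in> {0..}" "dist s t < min d 1" for s
  proof -
    have "norm (T s x - T t x) \<le> M * norm (T \<bar>s - t\<bar> x - x)"
      using t that M by (intro T_diff_le[where a="t + 1"]) (auto simp: dist_real_def)
    also have "\<dots> < M * (e / M)"
      using d(2)[of "\<bar>s - t\<bar>"] that M(1) by (intro mult_strict_left_mono) (auto simp: dist_real_def)
    finally show ?thesis using M(1) by (simp add: dist_norm)
  qed
  then show "\<exists>d>0. \<forall>s\<in>{0..}. dist s t < d \<longrightarrow> dist (T s x) (T t x) < e"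
    using d(1) by (intro exI[of _ "min d 1"]) auto
qed

lemma T_G_near_zero:
  assumes "e > 0"
  shows "\<exists>d>0. \<forall>h. 0 \<le> h \<and> h < d \<longrightarrow> norm (T h (G y) - G y - h *\<^sub>R y) \<le> e * h"
proof -
  have "((\<lambda>h. norm ((1 / h) *\<^sub>R (T h (G y) - G y) - y)) \<longlongrightarrow> 0) (at_right 0)"
    using generator_iff by blast
  from order_tendstoD(2)[OF this assms] obtain d where d: "d > 0"
      "\<And>h. h > 0 \<Longrightarrow> h < d \<Longrightarrow> norm ((1 / h) *\<^sub>R (T h (G y) - G y) - y) < e"
    unfolding eventually_at_right_field by blast
  have "norm (T h (G y) - G y - h *\<^sub>R y) \<le> e * h" if h: "0 \<le> h" "h < d" for h
  proof (cases "h = 0")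
    case False
    have "T h (G y) - G y - h *\<^sub>R y = h *\<^sub>R ((1 / h) *\<^sub>R (T h (G y) - G y) - y)"
      using False by (simp add: scaleR_diff_right)
    then have "norm (T h (G y) - G y - h *\<^sub>R y) = h * norm ((1 / h) *\<^sub>R (T h (G y) - G y) - y)"
      using h by (metis abs_of_nonneg norm_scaleR)
    also have "\<dots> \<le> h * e" using d(2)[of h] h False by (intro mult_left_mono) auto
    finally show ?thesis by (simp add: mult.commute)
  qed (simp add: T_zero)
  then show ?thesis using d(1) by blast
qed

text \<open>The generator only supplies the right derivative at 0. To the right of \<open>t\<close>
  its remainder is carried along by \<open>T t\<close>. To the left it is carried by
  \<open>T s\<close>, so the slope comes out as \<open>T s y\<close>, and continuity of the orbit
  replaces it by \<open>T t y\<close>.\<close>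

lemma T_G_has_vector_derivative:
  assumes t: "t \<ge> 0"
  shows "((\<lambda>s. T s (G y)) has_vector_derivative T t y) (at t within {0..})"
proof -
  obtain M where M: "M \<ge> 1" "\<And>s x. s \<in> {0..t + 1} \<Longrightarrow> norm (T s x) \<le> M * norm x"
    using T_locally_bounded[of "t + 1"] by blast
  have "\<exists>d>0. \<forall>s\<in>{0..}. norm (s - t) < d \<longrightarrow>
      norm (T s (G y) - T t (G y) - (s - t) *\<^sub>R T t y) \<le> e * norm (s - t)" if e: "e > 0" for e
  proof -
    obtain d1 where d1: "d1 > 0"
        "\<And>h. 0 \<le> h \<Longrightarrow> h < d1 \<Longrightarrow> norm (T h (G y) - G y - h *\<^sub>R y) \<le> e / (2 * M) * h"
      using T_G_near_zero[of "e / (2 * M)" y] e M(1) by auto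
    obtain d2 where d2: "d2 > 0" "\<And>s. s \<in> {0..} \<Longrightarrow> dist s t < d2 \<Longrightarrow> dist (T s y) (T t y) < e / 2"
      using continuous_on_T[of y, unfolded continuous_on_iff, rule_format, of t "e / 2"] t e by auto
    have "norm (T s (G y) - T t (G y) - (s - t) *\<^sub>R T t y) \<le> e * norm (s - t)"
      if s: "s \<in> {0..}" "norm (s - t) < min (min d1 d2) 1" for s
    proof (cases "t \<le> s")
      case True
      interpret bounded_linear "T t" using t bounded_linear_T by auto
      have "T s (G y) - T t (G y) - (s - t) *\<^sub>R T t y
          = T t (T (s - t) (G y) - G y - (s - t) *\<^sub>R y)"
        using T_add[of t "s - t" "G y"] True t by (simp add: diff scaleR)
      also have "norm \<dots> \<le> M * norm (T (s - t) (G y) - G y - (s - t) *\<^sub>R y)" using t by (intro M) auto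
      also have "\<dots> \<le> M * (e / (2 * M) * (s - t))"
        using True s M(1) by (intro mult_left_mono d1) auto
      also have "\<dots> = e / 2 * (s - t)" using M(1) by simp
      also have "\<dots> \<le> e * norm (s - t)" using e True by simp
      finally show ?thesis .
    next
      case False
      define h where "h = t - s"
      interpret bounded_linear "T s" using s bounded_linear_T by auto
      have "T s (G y) - T t (G y) - (s - t) *\<^sub>R T t y
          = h *\<^sub>R (T t y - T s y) - T s (T h (G y) - G y - h *\<^sub>R y)"
        using T_add[of s h "G y"] False s by (simp add: diff scaleR h_def scaleR_diff_left scaleR_diff_right)
      also have "norm \<dots> \<le> norm (h *\<^sub>R (T t y - T s y)) + norm (T s (T h (G y) - G y - h *\<^sub>R y))"
        by (rule norm_triangle_ineq4)
      also have "norm (T s (T h (G y) - G y - h *\<^sub>R y)) \<le> M * norm (T h (G y) - G y - h *\<^sub>R y)"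
        using s False by (intro M) auto
      also have "\<dots> \<le> M * (e / (2 * M) * h)"
        using False s M(1) by (intro mult_left_mono d1) (auto simp: h_def)
      also have "\<dots> = e / 2 * h" using M(1) by simp
      also have "norm (h *\<^sub>R (T t y - T s y)) \<le> h * (e / 2)"
        using d2(2)[of s] s False
        by (auto simp: h_def dist_norm norm_minus_commute intro!: mult_left_mono less_imp_le)
      finally show ?thesis using False by (simp add: h_def)
    qed
    then show ?thesis using d1(1) d2(1) by (intro exI[of _ "min (min d1 d2) 1"]) auto
  qed
  then show ?thesis
    unfolding has_vector_derivative_def has_derivative_within_alt
    by (auto simp: bounded_linear_scaleR_left)
qed

text \<open>The difference quotient at \<open>T t (G y)\<close> is \<open>T t\<close> applied to the
  one at \<open>G y\<close>, so it converges to \<open>T t y\<close>. Read through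
  \<open>generator_iff\<close>, this is the claim.\<close>

lemma T_G_commute:
  assumes t: "t \<ge> 0"
  shows "T t (G y) = G (T t y)"
proof -
  interpret bounded_linear "T t" using t bounded_linear_T by auto
  obtain M where M: "M \<ge> 1" "\<And>x. norm (T t x) \<le> M * norm x"
    using T_locally_bounded[of t] t by (metis atLeastAtMost_iff order_refl)
  have "((\<lambda>h. norm ((1 / h) *\<^sub>R (T h (G y) - G y) - y)) \<longlongrightarrow> 0) (at_right 0)"
    using generator_iff by blast
  then have "((\<lambda>h. M * norm ((1 / h) *\<^sub>R (T h (G y) - G y) - y)) \<longlongrightarrow> 0) (at_right 0)"
    by (rule tendsto_mult_right_zero)
  moreover have "\<forall>\<^sub>F h in at_right 0. norm (norm ((1 / h) *\<^sub>R (T h (T t (G y)) - T t (G y)) - T t y))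
      \<le> M * norm ((1 / h) *\<^sub>R (T h (G y) - G y) - y)"
    unfolding eventually_at_right_field
  proof (intro exI[of _ 1] conjI allI impI)
    fix h :: real assume h: "0 < h" "h < 1"
    have "T h (T t (G y)) = T t (T h (G y))"
      using T_add[of h t "G y"] T_add[of t h "G y"] h t by (simp add: add.commute)
    then have "(1 / h) *\<^sub>R (T h (T t (G y)) - T t (G y)) - T t y
        = T t ((1 / h) *\<^sub>R (T h (G y) - G y) - y)"
      by (simp add: diff scaleR)
    then show "norm (norm ((1 / h) *\<^sub>R (T h (T t (G y)) - T t (G y)) - T t y))
      \<le> M * norm ((1 / h) *\<^sub>R (T h (G y) - G y) - y)" using M(2) by simp
  qed simp
  ultimately have "((\<lambda>h. norm ((1 / h) *\<^sub>R (T h (T t (G y)) - T t (G y)) - T t y)) \<longlongrightarrow> 0) (at_right 0)"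
    by (rule Lim_null_comparison[rotated])
  then show ?thesis using generator_iff by blast
qed

lemma T_G_pow_commute: "t \<ge> 0 \<Longrightarrow> T t ((G ^^ m) y) = (G ^^ m) (T t y)"
  by (induction m) (simp_all add: T_G_commute)

end

section \<open>The inverse of the generator\<close>

lemma norm_prod_le: "norm (x, y) \<le> norm x + norm y"
  by (metis norm_Pair norm_ge_zero sqrt_sum_squares_le_sum)

lemma norm_state_le:
  "norm x \<le> norm (fst x) + (norm (fst (snd x)) + (norm (fst (snd (snd x))) + norm (snd (snd (snd x)))))"
  using norm_prod_le[of "fst x" "snd x"] norm_prod_le[of "fst (snd x)" "snd (snd x)"]
    norm_prod_le[of "fst (snd (snd x))" "snd (snd (snd x))"] by simp

lemma bounded_linear_funpow:
  fixes f :: "'b::real_normed_vector \<Rightarrow> 'b"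
  assumes "bounded_linear f"
  shows "bounded_linear (f ^^ m)"
proof (induction m)
  case 0
  then show ?case by (simp add: id_def)
next
  case (Suc m)
  then show ?case using bounded_linear_compose[OF assms Suc] by (simp add: o_def)
qed

lemma symmetric_funpow:
  fixes f :: "'b::real_inner \<Rightarrow> 'b"
  assumes "\<And>x y. inner (f x) y = inner x (f y)"
  shows "inner ((f ^^ m) x) y = inner x ((f ^^ m) y)"
  by (induction m arbitrary: x) (simp_all add: assms funpow_swap1)

abbreviation a_of :: "'b \<times> 'b \<times> 'b \<times> 'b \<Rightarrow> 'b" where "a_of x \<equiv> fst x"
abbreviation p_of :: "'b \<times> 'b \<times> 'b \<times> 'b \<Rightarrow> 'b" where "p_of x \<equiv> fst (snd x)"
abbreviation b_of :: "'b \<times> 'b \<times> 'b \<times> 'b \<Rightarrow> 'b" where "b_of x \<equiv> fst (snd (snd x))"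
abbreviation q_of :: "'b \<times> 'b \<times> 'b \<times> 'b \<Rightarrow> 'b" where "q_of x \<equiv> snd (snd (snd x))"

text \<open>With \<open>a = S1 u\<close>, \<open>b = S2 v\<close>, \<open>R1 = S1\<inverse>\<close>, \<open>R2 = S2\<inverse>\<close>: the equation \<open>\<A>(u,p,v,q) = (f,g,h,k)\<close>
  after applying \<open>R1\<close>, \<open>R2\<close> to its lines, hence free of unbounded operators.\<close>

definition inverse_rel ::
  "('a::real_vector \<Rightarrow> 'a) \<Rightarrow> ('a \<Rightarrow> 'a) \<Rightarrow> ('a \<Rightarrow> 'a) \<Rightarrow> real \<Rightarrow> 'a state \<Rightarrow> 'a state \<Rightarrow> bool" where
  "inverse_rel R1 R2 B \<alpha> x y \<longleftrightarrow>
     p_of x = R1 (a_of y) \<and> q_of x = R2 (b_of y) \<and>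
     a_of x = - R1 (p_of y + B (p_of x) + \<alpha> *\<^sub>R R2 (b_of x)) \<and>
     b_of x = - R2 (q_of y + \<alpha> *\<^sub>R R1 (a_of x))"

locale coupled_bounds =
  fixes R1 R2 B :: "'a::{real_inner,complete_space} \<Rightarrow> 'a" and \<alpha> r1 r2 :: real
  assumes linear_R1: "bounded_linear R1" and linear_R2: "bounded_linear R2"
    and linear_B: "bounded_linear B"
    and r1_pos: "r1 > 0" and r2_pos: "r2 > 0"
    and R1_le: "norm (R1 x) \<le> r1 * norm x" and R2_le: "norm (R2 x) \<le> r2 * norm x"
    and weak_coupling: "\<bar>\<alpha>\<bar> * (r1 * r2) < 1"
begin

sublocale R1: bounded_linear R1 by (rule linear_R1)
sublocale R2: bounded_linear R2 by (rule linear_R2)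
sublocale B: bounded_linear B by (rule linear_B)

definition \<rho> where "\<rho> = \<bar>\<alpha>\<bar> * (r1 * r2)"

lemma rho_bounds: "0 \<le> \<rho>" "\<rho> < 1"
  using weak_coupling r1_pos r2_pos by (auto simp: \<rho>_def)

text \<open>The \<open>a\<close>-component of a solution is a fixed point of a \<open>\<rho>\<^sup>2\<close>-contraction.\<close>

lemma ex1_inverse_rel: "\<exists>!x. inverse_rel R1 R2 B \<alpha> x y"
proof -
  obtain f g h k where y: "y = (f, g, h, k)" by (cases y)
  define \<Phi> where "\<Phi> a = - R1 (g + B (R1 f) + \<alpha> *\<^sub>R R2 (- R2 (k + \<alpha> *\<^sub>R R1 a)))" for a
  have "dist (\<Phi> a) (\<Phi> a') \<le> \<rho>\<^sup>2 * dist a a'" for a a'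
  proof -
    have "\<Phi> a - \<Phi> a' = (\<alpha>\<^sup>2) *\<^sub>R R1 (R2 (R2 (R1 (a - a'))))"
      by (simp add: \<Phi>_def R1.diff R1.add R1.neg R1.scaleR R2.diff R2.add R2.neg R2.scaleR
          scaleR_diff_right scaleR_add_right power2_eq_square)
    then have "norm (\<Phi> a - \<Phi> a') = \<alpha>\<^sup>2 * norm (R1 (R2 (R2 (R1 (a - a')))))" by simp
    also have "norm (R1 (R2 (R2 (R1 (a - a'))))) \<le> r1 * (r2 * (r2 * (r1 * norm (a - a'))))"
      using r1_pos r2_pos by (meson R1_le R2_le mult_left_mono order.trans less_imp_le)
    also have "\<alpha>\<^sup>2 * (r1 * (r2 * (r2 * (r1 * norm (a - a'))))) = \<rho>\<^sup>2 * norm (a - a')"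
      by (simp add: \<rho>_def power2_eq_square algebra_simps)
    finally show ?thesis by (simp add: dist_norm mult_left_mono)
  qed
  moreover have "\<rho>\<^sup>2 < 1" using rho_bounds by (simp add: power_less_one_iff)
  ultimately have ex1: "\<exists>!a. \<Phi> a = a" by (intro banach_fix_type[of "\<rho>\<^sup>2"]) auto
  have iff: "inverse_rel R1 R2 B \<alpha> x y \<longleftrightarrow> \<Phi> (a_of x) = a_of x \<and>
     snd x = (R1 f, - R2 (k + \<alpha> *\<^sub>R R1 (a_of x)), R2 h)" for x
    by (cases x) (auto simp: inverse_rel_def y \<Phi>_def)
  then show ?thesis unfolding iff using ex1 by (metis prod.collapse fst_conv snd_conv)
qed

text \<open>With \<open>u = R1 a\<close> and \<open>v = R2 b\<close> this is the squared energy
  norm; the mixed term is its whole difference from the squared product norm.\<close>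

definition E :: "'a state \<Rightarrow> real" where
  "E x = (norm x)\<^sup>2 + 2 * \<alpha> * inner (R1 (a_of x)) (R2 (b_of x))"

text \<open>Together with \<open>\<rho> < 1\<close> this makes \<open>E\<close> equivalent to the
  squared product norm, which is where the smallness of the coupling enters.\<close>

lemma coupling_le: "\<bar>2 * \<alpha> * inner (R1 (a_of x)) (R2 (b_of x))\<bar> \<le> \<rho> * ((norm (a_of x))\<^sup>2 + (norm (b_of x))\<^sup>2)"
proof -
  have "\<bar>inner (R1 (a_of x)) (R2 (b_of x))\<bar> \<le> norm (R1 (a_of x)) * norm (R2 (b_of x))"
    by (rule Cauchy_Schwarz_ineq2)
  also have "\<dots> \<le> (r1 * norm (a_of x)) * (r2 * norm (b_of x))"
    using r1_pos by (intro mult_mono R1_le R2_le) auto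
  finally have "\<bar>2 * \<alpha> * inner (R1 (a_of x)) (R2 (b_of x))\<bar>
      \<le> 2 * \<bar>\<alpha>\<bar> * ((r1 * norm (a_of x)) * (r2 * norm (b_of x)))"
    by (simp add: abs_mult mult_left_mono)
  also have "\<dots> = \<rho> * (2 * norm (a_of x) * norm (b_of x))" by (simp add: \<rho>_def algebra_simps)
  also have "\<dots> \<le> \<rho> * ((norm (a_of x))\<^sup>2 + (norm (b_of x))\<^sup>2)"
    using rho_bounds sum_squares_bound by (intro mult_left_mono) auto
  finally show ?thesis .
qed

lemma norm_state: "(norm x)\<^sup>2 = (norm (a_of x))\<^sup>2 + (norm (p_of x))\<^sup>2 + (norm (b_of x))\<^sup>2 + (norm (q_of x))\<^sup>2"
  by (cases x) (simp add: norm_Pair)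

lemma norm_components:
  "norm (a_of x) \<le> norm x" "norm (p_of x) \<le> norm x" "norm (b_of x) \<le> norm x" "norm (q_of x) \<le> norm x"
  by (rule power2_le_imp_le; simp add: norm_state)+

lemma E_ge: "(1 - \<rho>) * (norm x)\<^sup>2 \<le> E x"
proof -
  have "\<rho> * ((norm (a_of x))\<^sup>2 + (norm (b_of x))\<^sup>2) \<le> \<rho> * (norm x)\<^sup>2"
    using rho_bounds by (intro mult_left_mono) (auto simp: norm_state)
  then show ?thesis using coupling_le[of x] by (simp add: E_def algebra_simps)
qed

lemma E_le: "E x \<le> 2 * (norm x)\<^sup>2"
proof -
  have "\<rho> * ((norm (a_of x))\<^sup>2 + (norm (b_of x))\<^sup>2) \<le> 1 * (norm x)\<^sup>2"
    using rho_bounds by (intro mult_mono) (auto simp: norm_state)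
  then show ?thesis using coupling_le[of x] by (simp add: E_def)
qed

lemma E_nonneg: "0 \<le> E x"
  using E_ge[of x] rho_bounds by (meson diff_ge_0_iff_ge less_imp_le mult_nonneg_nonneg order.trans zero_le_power2)

lemma continuous_E: "continuous_on UNIV E"
  unfolding E_def
  by (intro continuous_intros continuous_on_compose2[OF linear_continuous_on[OF linear_R1, of UNIV]]
      continuous_on_compose2[OF linear_continuous_on[OF linear_R2, of UNIV]]) auto

end

locale coupled_system = coupled_bounds R1 R2 B \<alpha> r1 r2
  for R1 R2 B :: "'a::{real_inner,complete_space} \<Rightarrow> 'a" and \<alpha> r1 r2 :: real +
  fixes G :: "'a state \<Rightarrow> 'a state"
  assumes G_iff: "x = G y \<longleftrightarrow> inverse_rel R1 R2 B \<alpha> x y"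
begin

lemma G_components:
  "p_of (G w) = R1 (a_of w)" "q_of (G w) = R2 (b_of w)"
  "a_of (G w) = - R1 (p_of w + B (p_of (G w)) + \<alpha> *\<^sub>R R2 (b_of (G w)))"
  "b_of (G w) = - R2 (q_of w + \<alpha> *\<^sub>R R1 (a_of (G w)))"
  using G_iff[of "G w" w] unfolding inverse_rel_def by blast+

text \<open>Linearity comes from uniqueness: sums and multiples of solutions satisfy the relation
  for the combined data. For boundedness, the first and third components of \<open>G w\<close> bound
  each other with factor \<open>\<rho>\<close>, so the loop closes because
  \<open>\<rho>\<^sup>2 < 1\<close>.\<close>

lemma bounded_linear_G: "bounded_linear G"
proof -
  have ar: "a_of (G w) = - R1 (p_of w) - R1 (B (R1 (a_of w))) - \<alpha> *\<^sub>R R1 (R2 (b_of (G w)))" for w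
    by (subst G_components(3)) (simp add: R1.add R1.scaleR G_components(1))
  have br: "b_of (G w) = - R2 (q_of w) - \<alpha> *\<^sub>R R2 (R1 (a_of (G w)))" for w
    by (subst G_components(4)) (simp add: R2.add R2.scaleR)
  obtain CB where CB: "CB \<ge> 0" "\<And>x. norm (B x) \<le> norm x * CB" using B.nonneg_bounded by blast
  \<comment> \<open>Obtained by inserting the bound \<open>b1\<close> below into \<open>a1\<close>
    and solving for the norm of the first component.\<close>
  define \<kappa> where "\<kappa> = (r1 + r1 * CB * r1 + \<rho> * r2) / (1 - \<rho>\<^sup>2)"
  have est: "norm (G w) \<le> (\<kappa> * (1 + \<rho>) + r2 + r1 + r2) * norm w" for w
  proof -
    let ?a = "norm (a_of (G w))" and ?b = "norm (b_of (G w))"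
    have tri: "norm (- x - y - z) \<le> norm x + norm y + norm z" for x y z :: 'a
      using norm_triangle_ineq4[of "- x - y" z] norm_triangle_ineq4[of "- x" y] by simp
    have R12: "norm (R1 (R2 x)) \<le> r1 * (r2 * norm x)" "norm (R2 (R1 x)) \<le> r2 * (r1 * norm x)" for x
      using r1_pos r2_pos by (meson R1_le R2_le mult_left_mono order.trans less_imp_le)+
    have "norm (R1 (B (R1 (a_of w)))) \<le> r1 * ((r1 * norm (a_of w)) * CB)"
      using r1_pos CB(1) by (meson CB(2) R1_le mult_left_mono mult_right_mono order.trans less_imp_le)
    also have "\<dots> \<le> r1 * ((r1 * norm w) * CB)"
      using r1_pos CB(1) by (intro mult_left_mono mult_right_mono norm_components) auto
    finally have 1: "norm (R1 (B (R1 (a_of w)))) \<le> r1 * CB * r1 * norm w" by (simp add: algebra_simps)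
    have 2: "norm (R1 (p_of w)) \<le> r1 * norm w" "norm (R2 (q_of w)) \<le> r2 * norm w"
      "norm (R1 (a_of w)) \<le> r1 * norm w" "norm (R2 (b_of w)) \<le> r2 * norm w"
      using r1_pos r2_pos
      by (meson R1_le R2_le norm_components mult_left_mono order.trans less_imp_le)+
    have "?a \<le> norm (R1 (p_of w)) + norm (R1 (B (R1 (a_of w)))) + norm (\<alpha> *\<^sub>R R1 (R2 (b_of (G w))))"
      by (subst ar) (rule tri)
    also have "norm (\<alpha> *\<^sub>R R1 (R2 (b_of (G w)))) \<le> \<rho> * ?b"
      using mult_left_mono[OF R12(1), of "\<bar>\<alpha>\<bar>" "b_of (G w)"] by (simp add: \<rho>_def algebra_simps)
    finally have a1: "?a \<le> r1 * norm w + r1 * CB * r1 * norm w + \<rho> * ?b" using 1 2 by linarith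
    have "?b \<le> norm (R2 (q_of w)) + norm (\<alpha> *\<^sub>R R2 (R1 (a_of (G w))))"
      using tri[of 0 "R2 (q_of w)" "\<alpha> *\<^sub>R R2 (R1 (a_of (G w)))"] by (subst br) simp
    also have "norm (\<alpha> *\<^sub>R R2 (R1 (a_of (G w)))) \<le> \<rho> * ?a"
      using mult_left_mono[OF R12(2), of "\<bar>\<alpha>\<bar>" "a_of (G w)"] by (simp add: \<rho>_def algebra_simps)
    finally have b1: "?b \<le> r2 * norm w + \<rho> * ?a" using 2 by linarith
    have "\<rho> * ?b \<le> \<rho> * (r2 * norm w + \<rho> * ?a)" using b1 rho_bounds by (intro mult_left_mono) auto
    then have "?a * (1 - \<rho>\<^sup>2) \<le> (r1 + r1 * CB * r1 + \<rho> * r2) * norm w"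
      using a1 by (simp add: algebra_simps power2_eq_square)
    moreover have pos: "1 - \<rho>\<^sup>2 > 0" using rho_bounds by (simp add: power_less_one_iff)
    ultimately have a2: "?a \<le> \<kappa> * norm w"
      by (simp add: \<kappa>_def field_simps)
    have "\<rho> * ?a \<le> \<rho> * (\<kappa> * norm w)" using a2 rho_bounds by (intro mult_left_mono) auto
    then have b2: "?b \<le> r2 * norm w + \<rho> * (\<kappa> * norm w)" using b1 by linarith
    have "norm (G w) \<le> ?a + (norm (p_of (G w)) + (?b + norm (q_of (G w))))"
      by (rule norm_state_le)
    then show ?thesis using a2 b2 2 by (simp add: G_components(1,2) algebra_simps)
  qed
  show ?thesis
  proof (rule bounded_linear_intro)
    show "norm (G w) \<le> norm w * (\<kappa> * (1 + \<rho>) + r2 + r1 + r2)" for w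
      using est[of w] by (simp add: mult.commute)
    show "G (x + y) = G x + G y" for x y
    proof -
      have a: "a_of (G x + G y) = - R1 (p_of (x + y) + B (p_of (G x + G y)) + \<alpha> *\<^sub>R R2 (b_of (G x + G y)))"
      proof -
        have "a_of (G x + G y) = - R1 (p_of x + B (p_of (G x)) + \<alpha> *\<^sub>R R2 (b_of (G x))) + - R1 (p_of y + B (p_of (G y)) + \<alpha> *\<^sub>R R2 (b_of (G y)))"
          unfolding fst_add by (rule arg_cong2[OF G_components(3) G_components(3)])
        also have "\<dots> = - R1 (p_of (x + y) + B (p_of (G x + G y)) + \<alpha> *\<^sub>R R2 (b_of (G x + G y)))"
          by (simp add: G_components(1,2) R1.add R2.add B.add R1.scaleR R2.scaleR B.scaleR scaleR_add_right scaleR_diff_right mult.commute)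
        finally show ?thesis .
      qed
      have b: "b_of (G x + G y) = - R2 (q_of (x + y) + \<alpha> *\<^sub>R R1 (a_of (G x + G y)))"
      proof -
        have "b_of (G x + G y) = - R2 (q_of x + \<alpha> *\<^sub>R R1 (a_of (G x))) + - R2 (q_of y + \<alpha> *\<^sub>R R1 (a_of (G y)))"
          unfolding fst_add snd_add by (rule arg_cong2[OF G_components(4) G_components(4)])
        also have "\<dots> = - R2 (q_of (x + y) + \<alpha> *\<^sub>R R1 (a_of (G x + G y)))"
          by (simp add: G_components(1,2) R1.add R2.add B.add R1.scaleR R2.scaleR B.scaleR scaleR_add_right scaleR_diff_right mult.commute)
        finally show ?thesis .
      qed
      have "inverse_rel R1 R2 B \<alpha> (G x + G y) (x + y)"
        unfolding inverse_rel_def by (intro conjI a b) (simp_all add: G_components(1,2) R1.add R2.add)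
      then show ?thesis by (simp add: G_iff[symmetric])
    qed
    show "G (r *\<^sub>R x) = r *\<^sub>R G x" for r x
    proof -
      have a: "a_of (r *\<^sub>R G x) = - R1 (p_of (r *\<^sub>R x) + B (p_of (r *\<^sub>R G x)) + \<alpha> *\<^sub>R R2 (b_of (r *\<^sub>R G x)))"
      proof -
        have "a_of (r *\<^sub>R G x) = r *\<^sub>R (- R1 (p_of x + B (p_of (G x)) + \<alpha> *\<^sub>R R2 (b_of (G x))))"
          unfolding fst_scaleR by (rule arg_cong[OF G_components(3)])
        also have "\<dots> = - R1 (p_of (r *\<^sub>R x) + B (p_of (r *\<^sub>R G x)) + \<alpha> *\<^sub>R R2 (b_of (r *\<^sub>R G x)))"
          by (simp add: G_components(1,2) R1.add R2.add B.add R1.scaleR R2.scaleR B.scaleR scaleR_add_right scaleR_diff_right mult.commute)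
        finally show ?thesis .
      qed
      have b: "b_of (r *\<^sub>R G x) = - R2 (q_of (r *\<^sub>R x) + \<alpha> *\<^sub>R R1 (a_of (r *\<^sub>R G x)))"
      proof -
        have "b_of (r *\<^sub>R G x) = r *\<^sub>R (- R2 (q_of x + \<alpha> *\<^sub>R R1 (a_of (G x))))"
          unfolding fst_scaleR snd_scaleR by (rule arg_cong[OF G_components(4)])
        also have "\<dots> = - R2 (q_of (r *\<^sub>R x) + \<alpha> *\<^sub>R R1 (a_of (r *\<^sub>R G x)))"
          by (simp add: G_components(1,2) R1.add R2.add B.add R1.scaleR R2.scaleR B.scaleR scaleR_add_right scaleR_diff_right mult.commute)
        finally show ?thesis .
      qed
      have "inverse_rel R1 R2 B \<alpha> (r *\<^sub>R G x) (r *\<^sub>R x)"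
        unfolding inverse_rel_def by (intro conjI a b) (simp_all add: G_components(1,2) R1.scaleR R2.scaleR)
      then show ?thesis by (simp add: G_iff[symmetric])
    qed
  qed
qed

text \<open>Two applications of \<open>G\<close> undo two time derivatives, so this is the second
  wave equation, with \<open>R2 \<circ> R2\<close> in the role of the inverse of A2.\<close>

lemma q_of_G_G: "q_of (G (G w)) = - R2 (R2 (q_of w + \<alpha> *\<^sub>R p_of (G (G w))))"
  by (simp add: G_components(1)[of "G w"] G_components(2)[of "G w"])
     (subst G_components(4), simp add: R2.neg)

end

section \<open>Observables along the flow\<close>

lemma young_le: "x * y \<le> e * x\<^sup>2 + (1 / (4 * e)) * y\<^sup>2" if "e > 0" for x y e :: real
proof -
  have "0 \<le> (2 * e * x - y)\<^sup>2 / (4 * e)" using that by simp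
  also have "\<dots> = e * x\<^sup>2 + (1 / (4 * e)) * y\<^sup>2 - x * y"
    using that by (simp add: power2_eq_square field_simps)
  finally show ?thesis by simp
qed

lemma abs_inner_bounded_linear:
  assumes "bounded_linear f" "bounded_linear g"
  shows "\<exists>C\<ge>0. \<forall>x y. \<bar>inner (f x) (g y)\<bar> \<le> C * norm x * norm y"
proof -
  obtain Cf where Cf: "Cf > 0" "\<And>x. norm (f x) \<le> norm x * Cf"
    using bounded_linear.pos_bounded[OF assms(1)] by blast
  obtain Cg where Cg: "Cg > 0" "\<And>x. norm (g x) \<le> norm x * Cg"
    using bounded_linear.pos_bounded[OF assms(2)] by blast
  have "\<bar>inner (f x) (g y)\<bar> \<le> (Cf * Cg) * norm x * norm y" for x y
  proof -
    have "\<bar>inner (f x) (g y)\<bar> \<le> norm (f x) * norm (g y)" by (rule Cauchy_Schwarz_ineq2)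
    also have "\<dots> \<le> (norm x * Cf) * (norm y * Cg)" using Cf Cg by (intro mult_mono) auto
    finally show ?thesis by (simp add: algebra_simps)
  qed
  then show ?thesis using Cf Cg by (intro exI[of _ "Cf * Cg"]) auto
qed

context c0_semigroup
begin

text \<open>The derivative is kept as a functional of the state, so identities in time become
  pointwise identities in \<open>y\<close>. At time 0 it is one-sided.\<close>

definition flow_deriv :: "('b \<Rightarrow> real) \<Rightarrow> ('b \<Rightarrow> real) \<Rightarrow> bool" where
  "flow_deriv F F' \<longleftrightarrow>
     (\<forall>t\<ge>0. \<forall>y. ((\<lambda>s. F (T s y)) has_real_derivative F' (T t y)) (at t within {0..}))"

lemma flow_deriv_add: "flow_deriv F F' \<Longrightarrow> flow_deriv H H' \<Longrightarrow> flow_deriv (\<lambda>y. F y + H y) (\<lambda>y. F' y + H' y)"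
  by (auto simp: flow_deriv_def intro!: derivative_intros)

lemma flow_deriv_cmult: "flow_deriv F F' \<Longrightarrow> flow_deriv (\<lambda>y. c * F y) (\<lambda>y. c * F' y)"
  by (auto simp: flow_deriv_def intro!: DERIV_cmult)

lemma flow_deriv_sum:
  "(\<And>i. i \<in> I \<Longrightarrow> flow_deriv (F i) (F' i)) \<Longrightarrow> flow_deriv (\<lambda>y. \<Sum>i\<in>I. F i y) (\<lambda>y. \<Sum>i\<in>I. F' i y)"
  by (auto simp: flow_deriv_def intro!: DERIV_sum)

text \<open>Each time derivative uses up one factor \<open>G\<close>, so both arguments must carry
  at least one. This restricts which indices can be differentiated.\<close>

lemma flow_deriv_inner:
  fixes f g :: "'b \<Rightarrow> 'c::real_inner"
  assumes "bounded_linear f" "bounded_linear g" "m = Suc m'" "n = Suc n'"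
  shows "flow_deriv (\<lambda>y. inner (f ((G ^^ m) y)) (g ((G ^^ n) y)))
    (\<lambda>y. inner (f ((G ^^ m') y)) (g ((G ^^ n) y)) + inner (f ((G ^^ m) y)) (g ((G ^^ n') y)))"
  unfolding flow_deriv_def
proof (intro allI impI)
  fix t :: real and y assume t: "t \<ge> 0"
  have d: "((\<lambda>s. h ((G ^^ Suc k) (T s y))) has_derivative (\<lambda>r. r *\<^sub>R h ((G ^^ k) (T t y)))) (at t within {0..})"
    if h: "bounded_linear h" for h :: "'b \<Rightarrow> 'c" and k
  proof -
    interpret h: bounded_linear h by (rule h)
    have "((\<lambda>s. T s (G ((G ^^ k) y))) has_derivative (\<lambda>r. r *\<^sub>R T t ((G ^^ k) y))) (at t within {0..})"
      using T_G_has_vector_derivative[OF t] by (simp add: has_vector_derivative_def)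
    from h.has_derivative[OF this]
    have "((\<lambda>s. h (T s (G ((G ^^ k) y)))) has_derivative (\<lambda>r. r *\<^sub>R h (T t ((G ^^ k) y)))) (at t within {0..})"
      by (simp add: h.scaleR)
    \<comment> \<open>\<open>T s\<close> is exchanged with powers of \<open>G\<close> at nonnegative
      times only, which suffices because the derivative is taken within the half line.\<close>
    then show ?thesis
      by (rule has_derivative_transform_within[OF _ zero_less_one, THEN has_derivative_eq_rhs])
         (use t T_G_pow_commute[of _ "Suc k" y] in \<open>auto simp: T_G_pow_commute\<close>)
  qed
  show "((\<lambda>s. inner (f ((G ^^ m) (T s y))) (g ((G ^^ n) (T s y)))) has_real_derivative
      inner (f ((G ^^ m') (T t y))) (g ((G ^^ n) (T t y))) +
      inner (f ((G ^^ m) (T t y))) (g ((G ^^ n') (T t y)))) (at t within {0..})"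
    unfolding assms(3,4) has_field_derivative_def
    by (rule has_derivative_eq_rhs, rule has_derivative_inner[OF d[OF assms(1)] d[OF assms(2)]])
       (auto simp: algebra_simps)
qed

end

text \<open>\<open>K\<close> stands for A1 A2^(-j/2). Then \<open>R2_pow_eq\<close> is the
  comparison of A1 with A2^(j/2), expressed by bounded operators alone.\<close>

locale coupled_semigroup = coupled_system R1 R2 B \<alpha> r1 r2 G + c0_semigroup T G
  for R1 R2 B :: "'a::{real_inner,complete_space} \<Rightarrow> 'a" and \<alpha> r1 r2 :: real
    and G :: "'a state \<Rightarrow> 'a state" and T +
  fixes K :: "'a \<Rightarrow> 'a" and \<beta> :: real and j :: nat
  assumes linear_K: "bounded_linear K"
    and R1_symmetric: "inner (R1 x) y = inner x (R1 y)"
    and R2_symmetric: "inner (R2 x) y = inner x (R2 y)"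
    and R2_pow_eq: "(R2 ^^ j) x = R1 (R1 (K x))"
    and coercive_B: "inner (B x) x \<ge> \<beta> * (norm x)\<^sup>2" and beta_pos: "\<beta> > 0"
    and alpha_nonzero: "\<alpha> \<noteq> 0"
    and j_ge_2: "j \<ge> 2"
begin

sublocale K: bounded_linear K by (rule linear_K)

text \<open>With \<open>U0 = G\<^bsup>j+2\<^esup> y\<close>, the components at time \<open>t\<close> are \<open>P m = u\<^bsup>(j+3-m)\<^esup>\<close> and
  \<open>Q m = v\<^bsup>(j+3-m)\<^esup>\<close>: differentiating in time lowers the index. Two derivatives more than \<open>U0 \<in> D(\<A>\<^sup>j)\<close>
  provides make every functional below differentiable; density removes them at the end.\<close>

definition P where "P m y = p_of ((G ^^ m) y)"
definition Q where "Q m y = q_of ((G ^^ m) y)"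
definition R where "R m = R2 ^^ m"

lemma linear_R: "bounded_linear (R m)"
  unfolding R_def by (rule bounded_linear_funpow[OF linear_R2])

sublocale R: bounded_linear "R m" for m by (rule linear_R)

lemma R_symmetric: "inner (R m x) y = inner x (R m y)"
  unfolding R_def by (rule symmetric_funpow[OF R2_symmetric])

lemma R_R: "R m (R n x) = R (m + n) x"
  by (simp add: R_def funpow_add)

lemma inner_R_R: "inner (R m x) (R n y) = inner (R (m + n) x) y"
  by (simp add: R_symmetric R_R)

lemmas linear_intros =
  bounded_linear_compose[OF linear_R] bounded_linear_compose[OF linear_K] bounded_linear_compose[OF linear_B]
  bounded_linear_compose[OF linear_R1] bounded_linear_compose[OF linear_R2]
  bounded_linear_fst_comp bounded_linear_snd_comp bounded_linear_ident

text \<open>The second equation as an exchange rule: \<open>Q m\<close> has two time derivatives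
  more than \<open>Q (m + 2)\<close>, and two powers of \<open>R2\<close> pay for them, up to a term
  in \<open>u\<close>.\<close>

lemma Q_eq: "R (Suc (Suc i)) (Q m y) = - R i (Q (m + 2) y) - \<alpha> *\<^sub>R R (Suc (Suc i)) (P (m + 2) y)"
proof -
  have "Q (m + 2) y = - R 2 (Q m y + \<alpha> *\<^sub>R P (m + 2) y)"
    using q_of_G_G[of "(G ^^ m) y"] by (simp add: Q_def P_def R_def numeral_2_eq_2)
  then have "R i (Q (m + 2) y) = R i (- R 2 (Q m y + \<alpha> *\<^sub>R P (m + 2) y))" by simp
  then show ?thesis
    by (simp add: R.neg R.add R.diff R.scaleR R_R)
qed

text \<open>The first equation tested with \<open>R j x\<close>. The missing term A1 u is moved onto
  the test vector, where A1 composed with \<open>R j\<close> is the bounded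
  \<open>K\<close>.\<close>

lemma P_eq: "inner (P m y + B (P (m + 1) y) + \<alpha> *\<^sub>R Q (m + 2) y) (R j x) = - inner (P (m + 2) y) (K x)"
proof -
  define w where "w = (G ^^ m) y"
  have "inner (P m y + B (P (m + 1) y) + \<alpha> *\<^sub>R Q (m + 2) y) (R j x)
      = inner (R1 (R1 (p_of w + B (p_of (G w)) + \<alpha> *\<^sub>R R2 (b_of (G w))))) (K x)"
    by (simp add: P_def Q_def R_def R2_pow_eq R1_symmetric w_def G_components(2)[of "G w", unfolded w_def])
  also have "R1 (p_of w + B (p_of (G w)) + \<alpha> *\<^sub>R R2 (b_of (G w))) = - a_of (G w)"
    by (subst G_components(3)) simp
  also have "R1 (- a_of (G w)) = - P (m + 2) y"
    by (simp add: P_def w_def R1.neg G_components(1)[of "G w", unfolded w_def])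
  finally show ?thesis by simp
qed

end

section \<open>The Lyapunov functional\<close>

declare split_paired_All [simp del] split_paired_Ex [simp del]

context coupled_semigroup
begin

text \<open>Since U0 is \<open>(G ^^ (j + 2)) y\<close>, the range of \<open>m\<close> collects the
  energies of U, U', ..., U^(j), and \<open>D\<close> collects the matching |u'|^2, ...,
  |u^(j+1)|^2.\<close>

definition S where "S y = (\<Sum>m=2..j + 2. E ((G ^^ m) y))"
definition D where "D y = (\<Sum>m=2..j + 2. (norm (P m y))\<^sup>2)"

text \<open>Functionals of this kind can be absorbed into a large multiple of \<open>S\<close>,
  which keeps the final Lyapunov functional nonnegative.\<close>

definition S_bounded :: "('a state \<Rightarrow> real) \<Rightarrow> bool" where
  "S_bounded F \<longleftrightarrow> (\<exists>C. \<forall>y. \<bar>F y\<bar> \<le> C * S y)"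

text \<open>Functionals whose time integral is bounded by the initial energies: the dissipation \<open>D\<close> is
  integrable, and \<open>F'\<close> integrates to boundary terms.\<close>

definition controlled :: "('a state \<Rightarrow> real) \<Rightarrow> bool" where
  "controlled f \<longleftrightarrow> (\<exists>C F F'. C \<ge> 0 \<and> flow_deriv F F' \<and> S_bounded F \<and> (\<forall>y. f y \<le> C * D y + F' y))"

lemma S_nonneg: "0 \<le> S y" unfolding S_def by (intro sum_nonneg E_nonneg)
lemma D_nonneg: "0 \<le> D y" unfolding D_def by (intro sum_nonneg) auto

lemma E_le_S: "m \<in> {2..j + 2} \<Longrightarrow> E ((G ^^ m) y) \<le> S y"
  unfolding S_def by (rule member_le_sum) (auto simp: E_nonneg)

lemma norm_G_pow_le: "m \<in> {2..j + 2} \<Longrightarrow> (norm ((G ^^ m) y))\<^sup>2 \<le> S y / (1 - \<rho>)"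
  using E_ge[of "(G ^^ m) y"] E_le_S[of m y] rho_bounds by (simp add: field_simps)

lemma S_bounded_add: "S_bounded F \<Longrightarrow> S_bounded H \<Longrightarrow> S_bounded (\<lambda>y. F y + H y)"
  unfolding S_bounded_def
proof (elim exE)
  fix C C' assume "\<forall>y. \<bar>F y\<bar> \<le> C * S y" "\<forall>y. \<bar>H y\<bar> \<le> C' * S y"
  then have "\<bar>F y + H y\<bar> \<le> (C + C') * S y" for y
    unfolding distrib_right by (intro order_trans[OF abs_triangle_ineq] add_mono) auto
  then show "\<exists>C. \<forall>y. \<bar>F y + H y\<bar> \<le> C * S y" by blast
qed

lemma S_bounded_cmult: "S_bounded F \<Longrightarrow> S_bounded (\<lambda>y. c * F y)"
  unfolding S_bounded_def
proof (elim exE)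
  fix C assume "\<forall>y. \<bar>F y\<bar> \<le> C * S y"
  then have "\<bar>c * F y\<bar> \<le> (\<bar>c\<bar> * C) * S y" for y
    by (simp add: abs_mult mult.assoc mult_left_mono)
  then show "\<exists>C. \<forall>y. \<bar>c * F y\<bar> \<le> C * S y" by blast
qed

lemma S_bounded_inner:
  assumes "bounded_linear f" "bounded_linear g" "m \<in> {2..j + 2}" "n \<in> {2..j + 2}"
  shows "S_bounded (\<lambda>y. inner (f ((G ^^ m) y)) (g ((G ^^ n) y)))"
proof -
  obtain C where C: "C \<ge> 0" "\<And>x y. \<bar>inner (f x) (g y)\<bar> \<le> C * norm x * norm y"
    using abs_inner_bounded_linear[OF assms(1,2)] by blast
  have avg: "a \<le> c \<Longrightarrow> b \<le> c \<Longrightarrow> (a + b) / 2 \<le> c" for a b c :: real by simp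
  have "\<bar>inner (f ((G ^^ m) y)) (g ((G ^^ n) y))\<bar> \<le> C / (1 - \<rho>) * S y" for y
  proof -
    have "norm ((G ^^ m) y) * norm ((G ^^ n) y) \<le> ((norm ((G ^^ m) y))\<^sup>2 + (norm ((G ^^ n) y))\<^sup>2) / 2"
      using sum_squares_bound[of "norm ((G ^^ m) y)" "norm ((G ^^ n) y)"] by simp
    also have "\<dots> \<le> S y / (1 - \<rho>)" by (rule avg[OF norm_G_pow_le[OF assms(3)] norm_G_pow_le[OF assms(4)]])
    finally have "C * (norm ((G ^^ m) y) * norm ((G ^^ n) y)) \<le> C * (S y / (1 - \<rho>))"
      using C by (intro mult_left_mono)
    then show ?thesis using C(2)[of "(G ^^ m) y" "(G ^^ n) y"] by (simp add: mult.assoc)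
  qed
  then show ?thesis unfolding S_bounded_def by blast
qed

lemma controlled_mono: "controlled g \<Longrightarrow> (\<And>y. f y \<le> g y) \<Longrightarrow> controlled f"
  unfolding controlled_def by (meson order_trans)

lemma controlled_add:
  assumes "controlled f" "controlled g"
  shows "controlled (\<lambda>y. f y + g y)"
proof -
  obtain C F F' where 1: "C \<ge> 0" "flow_deriv F F'" "S_bounded F" "\<And>y. f y \<le> C * D y + F' y"
    using assms(1) unfolding controlled_def by blast
  obtain C2 H H' where 2: "C2 \<ge> 0" "flow_deriv H H'" "S_bounded H" "\<And>y. g y \<le> C2 * D y + H' y"
    using assms(2) unfolding controlled_def by blast
  have "f y + g y \<le> (C + C2) * D y + (F' y + H' y)" for y
    using 1(4)[of y] 2(4)[of y] by (simp add: distrib_right)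
  then show ?thesis
    unfolding controlled_def
    using flow_deriv_add[OF 1(2) 2(2)] S_bounded_add[OF 1(3) 2(3)] 1(1) 2(1)
    by (intro exI[of _ "C + C2"] exI conjI) auto
qed

lemma controlled_cmult:
  assumes "controlled f" "c \<ge> 0"
  shows "controlled (\<lambda>y. c * f y)"
proof -
  obtain C F F' where 1: "C \<ge> 0" "flow_deriv F F'" "S_bounded F" "\<And>y. f y \<le> C * D y + F' y"
    using assms(1) unfolding controlled_def by blast
  have "c * f y \<le> (c * C) * D y + c * F' y" for y
    using mult_left_mono[OF 1(4) assms(2), of y] by (simp add: algebra_simps)
  then show ?thesis
    unfolding controlled_def
    using flow_deriv_cmult[OF 1(2), of c] S_bounded_cmult[OF 1(3), of c] 1(1) assms(2)
    by (intro exI[of _ "c * C"] exI conjI) auto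
qed

text \<open>Since \<open>c\<close> may have either sign, an identity for \<open>F'\<close> can be
  used in both directions.\<close>

lemma controlled_flow_deriv: "flow_deriv F F' \<Longrightarrow> S_bounded F \<Longrightarrow> controlled (\<lambda>y. c * F' y)"
  unfolding controlled_def using flow_deriv_cmult[of F F' c] S_bounded_cmult[of F c]
  by (intro exI[of _ 0] exI[of _ "\<lambda>y. c * F y"] exI[of _ "\<lambda>y. c * F' y"]) simp

lemma controlled_P: "m \<in> {2..j + 2} \<Longrightarrow> c \<ge> 0 \<Longrightarrow> controlled (\<lambda>y. c * (norm (P m y))\<^sup>2)"
proof (rule controlled_cmult)
  assume m: "m \<in> {2..j + 2}"
  have "flow_deriv (\<lambda>y. 0) (\<lambda>y. 0)" by (simp add: flow_deriv_def)
  moreover have "S_bounded (\<lambda>y. 0)" by (auto simp: S_bounded_def intro!: exI[of _ 0])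
  moreover have "(norm (P m y))\<^sup>2 \<le> 1 * D y + 0" for y
    using member_le_sum[OF m, of "\<lambda>m. (norm (P m y))\<^sup>2"] by (simp add: D_def)
  ultimately show "controlled (\<lambda>y. (norm (P m y))\<^sup>2)"
    unfolding controlled_def by (intro exI[of _ 1] exI conjI) auto
qed

lemma flow_deriv_PQ:
  assumes "bounded_linear f" "bounded_linear g" "m = Suc m'" "n = Suc n'"
  shows "flow_deriv (\<lambda>y. inner (f (P m y)) (g (Q n y)))
    (\<lambda>y. inner (f (P m' y)) (g (Q n y)) + inner (f (P m y)) (g (Q n' y)))"
  unfolding P_def Q_def by (rule flow_deriv_inner) (auto intro!: assms bounded_linear_compose[OF assms(1)]
      bounded_linear_compose[OF assms(2)] linear_intros)

lemma flow_deriv_QQ: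
  assumes "bounded_linear f" "bounded_linear g" "m = Suc m'" "n = Suc n'"
  shows "flow_deriv (\<lambda>y. inner (f (Q m y)) (g (Q n y)))
    (\<lambda>y. inner (f (Q m' y)) (g (Q n y)) + inner (f (Q m y)) (g (Q n' y)))"
  unfolding Q_def by (rule flow_deriv_inner) (auto intro!: assms bounded_linear_compose[OF assms(1)]
      bounded_linear_compose[OF assms(2)] linear_intros)

lemma linear_p: "bounded_linear (\<lambda>x :: 'a state. p_of x)" and linear_q: "bounded_linear (\<lambda>x :: 'a state. q_of x)"
  by (intro linear_intros)+

lemma S_bounded_PQ:
  assumes "bounded_linear f" "bounded_linear g" "m \<in> {2..j + 2}" "n \<in> {2..j + 2}"
  shows "S_bounded (\<lambda>y. inner (f (P m y)) (g (Q n y)))" "S_bounded (\<lambda>y. inner (f (P m y)) (g (P n y)))"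
    "S_bounded (\<lambda>y. inner (f (Q m y)) (g (Q n y)))"
  unfolding P_def Q_def
  using S_bounded_inner[OF bounded_linear_compose[OF assms(1) linear_p]
      bounded_linear_compose[OF assms(2) linear_q] assms(3,4)]
    S_bounded_inner[OF bounded_linear_compose[OF assms(1) linear_p]
      bounded_linear_compose[OF assms(2) linear_p] assms(3,4)]
    S_bounded_inner[OF bounded_linear_compose[OF assms(1) linear_q]
      bounded_linear_compose[OF assms(2) linear_q] assms(3,4)]
  by simp_all

text \<open>With i = j + 3 - m, this is v^(i) smoothed by i - 1 powers of \<open>R2\<close>: every
  derivative after the first is compensated by one power. The estimates start at \<open>z 2\<close>,
  which the first equation reaches, and climb to \<open>z (j + 2)\<close>, which is v'.\<close>

definition z where "z m y = R (j + 2 - m) (Q m y)"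

text \<open>Equipartition for \<open>R\<^sup>i v\<close>, which trades one time derivative for one power of \<open>R\<close>.\<close>

definition Y where "Y k y = inner (R (Suc (j - k)) (Q (k + 1) y)) (R (Suc (j - k)) (Q (k + 2) y))"
definition Y' where "Y' k y = (norm (z (k + 1) y))\<^sup>2 - (norm (z (k + 2) y))\<^sup>2
    - \<alpha> * inner (R (Suc (Suc (j - k))) (P (k + 2) y)) (z (k + 2) y)"

text \<open>In the term with \<open>Q k\<close>, one power of \<open>R2\<close> crosses the inner
  product. The left factor then has the two extra powers that \<open>Q_eq\<close> consumes, and the
  right factor becomes \<open>z (k + 2)\<close>.\<close>

lemma flow_deriv_Y:
  assumes "k \<le> j"
  shows "flow_deriv (Y k) (Y' k)"
proof -
  have "Y' k = (\<lambda>y. inner (R (Suc (j - k)) (Q k y)) (R (Suc (j - k)) (Q (k + 2) y))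
      + inner (R (Suc (j - k)) (Q (k + 1) y)) (R (Suc (j - k)) (Q (k + 1) y)))"
  proof
    fix y
    have "inner (R (Suc (j - k)) (Q k y)) (R (Suc (j - k)) (Q (k + 2) y))
        = inner (R (Suc (Suc (j - k))) (Q k y)) (z (k + 2) y)"
      unfolding inner_R_R z_def by (simp add: inner_R_R)
    also have "\<dots> = - (norm (z (k + 2) y))\<^sup>2 - \<alpha> * inner (R (Suc (Suc (j - k))) (P (k + 2) y)) (z (k + 2) y)"
      unfolding Q_eq by (simp add: z_def inner_diff_left power2_norm_eq_inner)
    finally show "Y' k y = inner (R (Suc (j - k)) (Q k y)) (R (Suc (j - k)) (Q (k + 2) y))
      + inner (R (Suc (j - k)) (Q (k + 1) y)) (R (Suc (j - k)) (Q (k + 1) y))"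
      using assms by (simp add: Y'_def z_def power2_norm_eq_inner Suc_diff_le)
  qed
  then show ?thesis
    using flow_deriv_QQ[OF linear_R linear_R, of "k + 1" k "k + 2" "k + 1" "Suc (j - k)" "Suc (j - k)"]
    by (simp add: Y_def[abs_def])
qed

text \<open>Only \<open>k = 0\<close> needs care, because \<open>Q 1\<close> lies below the index
  range of \<open>S\<close>. \<open>Q_eq\<close> raises it to index 3, which is within the
  range.\<close>

lemma S_bounded_Y:
  assumes "k \<le> j"
  shows "S_bounded (Y k)"
proof (cases "k = 0")
  case False
  then show ?thesis using assms unfolding Y_def[abs_def] by (intro S_bounded_PQ linear_R) auto
next
  case True
  have e: "Suc (Suc (j - 1)) = Suc j" using j_ge_2 by auto
  have "Y k = (\<lambda>y. - 1 * inner (R (j - 1) (Q 3 y)) (R (Suc j) (Q 2 y))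
      + - \<alpha> * inner (R (Suc j) (P 3 y)) (R (Suc j) (Q 2 y)))"
  proof
    fix y
    have "R (Suc j) (Q 1 y) = - R (j - 1) (Q 3 y) - \<alpha> *\<^sub>R R (Suc j) (P 3 y)"
      using Q_eq[of "j - 1" 1 y] unfolding e by (simp add: numeral_3_eq_3)
    then show "Y k y = - 1 * inner (R (j - 1) (Q 3 y)) (R (Suc j) (Q 2 y))
      + - \<alpha> * inner (R (Suc j) (P 3 y)) (R (Suc j) (Q 2 y))"
      by (simp add: Y_def True inner_diff_left numeral_2_eq_2)
  qed
  moreover have "S_bounded \<dots>"
    using j_ge_2 by (intro S_bounded_add S_bounded_cmult S_bounded_PQ linear_R) auto
  ultimately show ?thesis by simp
qed

lemma abs_alpha_inner_le: "\<exists>C\<ge>0. \<forall>x y. \<bar>\<alpha> * inner (R i x) y\<bar> \<le> C * norm x * norm y"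
  using abs_inner_bounded_linear[of "\<lambda>x. \<alpha> *\<^sub>R R i x" "\<lambda>x. x"] linear_R
  by (simp add: bounded_linear_ident bounded_linear_const_scaleR bounded_linear_scaleR_const)

lemma controlled_z_step:
  assumes "controlled (\<lambda>y. (norm (z (k + 1) y))\<^sup>2)" "k \<le> j"
  shows "controlled (\<lambda>y. (norm (z (k + 2) y))\<^sup>2)"
proof -
  obtain C where C: "C \<ge> 0"
    "\<And>x y. \<bar>\<alpha> * inner (R (Suc (Suc (j - k))) x) y\<bar> \<le> C * norm x * norm y"
    using abs_alpha_inner_le by blast
  \<comment> \<open>Young's inequality applied to the coupling term of \<open>Y' k\<close> returns
    half of the wanted square; absorbing it doubles all coefficients.\<close>
  have "controlled (\<lambda>y. 2 * (norm (z (k + 1) y))\<^sup>2 + C\<^sup>2 * (norm (P (k + 2) y))\<^sup>2 + (- 2) * Y' k y)"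
    using assms by (intro controlled_add controlled_cmult controlled_P
        controlled_flow_deriv[OF flow_deriv_Y S_bounded_Y]) auto
  moreover have "(norm (z (k + 2) y))\<^sup>2
      \<le> 2 * (norm (z (k + 1) y))\<^sup>2 + C\<^sup>2 * (norm (P (k + 2) y))\<^sup>2 + (- 2) * Y' k y" for y
    using C(2)[of "P (k + 2) y" "z (k + 2) y"]
      young_le[of "1 / 2" "norm (z (k + 2) y)" "C * norm (P (k + 2) y)"]
    by (simp add: Y'_def power_mult_distrib mult_ac)
  ultimately show ?thesis by (rule controlled_mono)
qed

text \<open>The coupling term \<open>\<alpha> v\<close> of the first equation, paired with \<open>R\<^bsup>2j\<^esup> v\<close>, gives \<open>\<alpha> |z|\<^sup>2\<close>. The terms of \<open>W\<close>
  are chosen so that every other term of its derivative contains a factor from \<open>P 2 = u\<^bsup>(j+1)\<^esup>\<close>, which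
  the damping controls.\<close>

definition W where "W y = inner (P 3 y) (K (R j (Q 2 y))) + \<alpha> * inner (Q 3 y) (R (2 * j) (Q 2 y))
    + inner (P 2 y) (R (2 * j) (Q 1 y))"
definition W' where "W' y = \<alpha> * (norm (z 2 y))\<^sup>2 + inner (P 2 y) (K (z 2 y))
    - inner (B (P 2 y)) (R (j - 1) (z 1 y))
    - inner (P 2 y) (R (j - 2) (z 2 y)) - \<alpha> * inner (P 2 y) (R (2 * j) (P 2 y))"

lemma flow_deriv_W: "flow_deriv W W'"
proof -
  have lin: "bounded_linear (\<lambda>x. K (R j x))" "bounded_linear (\<lambda>x :: 'a. x)" "bounded_linear (R (2 * j))"
    by (auto intro!: linear_intros linear_R)
  have n: "(3::nat) = Suc 2" "(2::nat) = Suc 1" "(1::nat) = Suc 0" by auto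
  have f: "flow_deriv W (\<lambda>y. (inner (P 2 y) (K (R j (Q 2 y))) + inner (P 3 y) (K (R j (Q 1 y))))
      + \<alpha> * (inner (Q 2 y) (R (2 * j) (Q 2 y)) + inner (Q 3 y) (R (2 * j) (Q 1 y)))
      + (inner (P 1 y) (R (2 * j) (Q 1 y)) + inner (P 2 y) (R (2 * j) (Q 0 y))))"
    unfolding W_def[abs_def]
    by (intro flow_deriv_add flow_deriv_cmult flow_deriv_PQ[OF lin(2,1) n(1,2)]
        flow_deriv_QQ[OF lin(2,3) n(1,2)] flow_deriv_PQ[OF lin(2,3) n(2,3)])
  have "(inner (P 2 y) (K (R j (Q 2 y))) + inner (P 3 y) (K (R j (Q 1 y))))
      + \<alpha> * (inner (Q 2 y) (R (2 * j) (Q 2 y)) + inner (Q 3 y) (R (2 * j) (Q 1 y)))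
      + (inner (P 1 y) (R (2 * j) (Q 1 y)) + inner (P 2 y) (R (2 * j) (Q 0 y))) = W' y" for y
  proof -
    \<comment> \<open>The first equation tested with \<open>R (2 * j) (Q 1 y)\<close> collapses the
      three terms of the derivative that contain \<open>Q 1\<close> into a single damping term with
      the factor \<open>P 2\<close>.\<close>
    have "inner (P 1 y + B (P 2 y) + \<alpha> *\<^sub>R Q 3 y) (R (2 * j) (Q 1 y)) = - inner (P 3 y) (K (R j (Q 1 y)))"
      using P_eq[of 1 y "R j (Q 1 y)"] by (simp add: R_R mult_2 numeral_2_eq_2 numeral_3_eq_3)
    then have 1: "inner (P 3 y) (K (R j (Q 1 y))) + inner (P 1 y) (R (2 * j) (Q 1 y))
        + \<alpha> * inner (Q 3 y) (R (2 * j) (Q 1 y)) = - inner (B (P 2 y)) (R (2 * j) (Q 1 y))"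
      by (simp add: inner_add_left)
    have 2: "R (2 * j) (Q 1 y) = R (j - 1) (z 1 y)"
      using j_ge_2 by (simp add: z_def R_R mult_2)
    have 3: "inner (Q 2 y) (R (2 * j) (Q 2 y)) = (norm (z 2 y))\<^sup>2"
      by (simp add: z_def power2_norm_eq_inner inner_R_R mult_2 R_symmetric R_R)
    \<comment> \<open>The term with \<open>Q 0\<close> has too many derivatives; the exchange rule
      brings it back to \<open>z 2\<close> and \<open>P 2\<close>.\<close>
    have "R (2 * j) (Q 0 y) = - R (j - 2) (z 2 y) - \<alpha> *\<^sub>R R (2 * j) (P 2 y)"
    proof -
      have e: "Suc (Suc (2 * j - 2)) = 2 * j" "j - 2 + j = 2 * j - 2" using j_ge_2 by auto
      have "R (2 * j) (Q 0 y) = - R (2 * j - 2) (Q (0 + 2) y) - \<alpha> *\<^sub>R R (2 * j) (P (0 + 2) y)"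
        using Q_eq[of "2 * j - 2" 0 y] unfolding e .
      moreover have "R (j - 2) (z 2 y) = R (2 * j - 2) (Q 2 y)"
        unfolding z_def R_R by (simp only: e(2) diff_add_inverse2)
      ultimately show ?thesis by (simp add: numeral_2_eq_2)
    qed
    then have 4: "inner (P 2 y) (R (2 * j) (Q 0 y))
        = - inner (P 2 y) (R (j - 2) (z 2 y)) - \<alpha> * inner (P 2 y) (R (2 * j) (P 2 y))"
      by (simp add: inner_diff_right)
    have 5: "R j (Q 2 y) = z 2 y" by (simp add: z_def)
    show ?thesis using 1 unfolding W'_def 2 3 4 5 distrib_left by linarith
  qed
  then show ?thesis using f by (simp add: fun_eq_iff[symmetric])
qed

text \<open>As for \<open>Y 0\<close>, the component \<open>Q 1\<close> is outside the range of
  \<open>S\<close> and is raised to index 3.\<close>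

lemma S_bounded_W: "S_bounded W"
proof -
  have lin: "bounded_linear (\<lambda>x. K (R j x))" "bounded_linear (\<lambda>x :: 'a. x)"
    by (auto intro!: linear_intros linear_R)
  have e: "2 * j = Suc (Suc (2 * j - 2))" using j_ge_2 by auto
  have "R (2 * j) (Q 1 y) = - R (2 * j - 2) (Q 3 y) - \<alpha> *\<^sub>R R (2 * j) (P 3 y)" for y
    using Q_eq[of "2 * j - 2" 1 y] by (simp add: e[symmetric] numeral_3_eq_3)
  then have "W = (\<lambda>y. inner (P 3 y) (K (R j (Q 2 y))) + \<alpha> * inner (Q 3 y) (R (2 * j) (Q 2 y))
     + (- 1 * inner (P 2 y) (R (2 * j - 2) (Q 3 y)) + - \<alpha> * inner (P 2 y) (R (2 * j) (P 3 y))))"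
    by (simp add: W_def[abs_def] inner_diff_right)
  moreover have "S_bounded \<dots>"
    using j_ge_2 by (intro S_bounded_add S_bounded_cmult S_bounded_PQ(1)[OF lin(2,1)]
        S_bounded_PQ[OF lin(2) linear_R]) auto
  ultimately show ?thesis by simp
qed

end

lemma decreasing_of_derivative_nonpos:
  fixes f :: "real \<Rightarrow> real"
  assumes "0 \<le> a" "a \<le> b"
    and d: "\<And>s. a \<le> s \<Longrightarrow> s \<le> b \<Longrightarrow> (f has_real_derivative f' s) (at s within {0..})"
    and le: "\<And>s. a \<le> s \<Longrightarrow> s \<le> b \<Longrightarrow> f' s \<le> 0"
  shows "f b \<le> f a"
proof (rule DERIV_nonpos_imp_decreasing_open[OF assms(2)])
  fix s assume s: "a < s" "s < b"
  then have "s \<in> interior {0::real..}" using assms(1) by simp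
  from at_within_interior[OF this] have "(f has_real_derivative f' s) (at s)"
    using d[of s] s by simp
  then show "\<exists>y. (f has_real_derivative y) (at s) \<and> y \<le> 0" using le[of s] s by auto
next
  have "continuous (at s within {a..b}) f" if "s \<in> {a..b}" for s
    using DERIV_continuous[OF d[of s]] that assms(1)
    by (auto intro: continuous_within_subset)
  then show "continuous_on {a..b} f" by (simp add: continuous_on_eq_continuous_within)
qed

context coupled_semigroup
begin

text \<open>Multiplying \<open>W'\<close> by \<open>sgn \<alpha>\<close> makes the coefficient of |z
  2|^2 positive. All its other terms contain \<open>P 2\<close>, so Young's inequality leaves
  dissipation and small multiples of |z 2|^2 and |z 1|^2. The latter is not yet known to be
  controlled; \<open>Y' 0\<close> bounds it by |z 2|^2, which is absorbed.\<close>

lemma controlled_z2: "controlled (\<lambda>y. (norm (z 2 y))\<^sup>2)"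
proof -
  obtain C1 where C1: "C1 \<ge> 0" "\<And>x y. \<bar>inner x (K y)\<bar> \<le> C1 * norm x * norm y"
    using abs_inner_bounded_linear[OF bounded_linear_ident linear_K] by blast
  obtain C2 where C2: "C2 \<ge> 0" "\<And>x y. \<bar>inner (B x) (R (j - 1) y)\<bar> \<le> C2 * norm x * norm y"
    using abs_inner_bounded_linear[OF linear_B linear_R] by blast
  obtain C3 where C3: "C3 \<ge> 0" "\<And>x y. \<bar>inner x (R (j - 2) y)\<bar> \<le> C3 * norm x * norm y"
    using abs_inner_bounded_linear[OF bounded_linear_ident linear_R] by blast
  obtain C4 where C4: "C4 \<ge> 0" "\<And>x y. \<bar>\<alpha> * inner (R (2 * j) x) y\<bar> \<le> C4 * norm x * norm y"
    using abs_alpha_inner_le by blast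
  obtain C5 where C5: "C5 \<ge> 0" "\<And>x y. \<bar>\<alpha> * inner (R (Suc (Suc j)) x) y\<bar> \<le> C5 * norm x * norm y"
    using abs_alpha_inner_le by blast
  define a where "a = \<bar>\<alpha>\<bar>"
  have a: "a > 0" using alpha_nonzero by (simp add: a_def)
  \<comment> \<open>Of the coefficient \<open>a\<close> of |z 2|^2, one quarter is spent by Young's
    inequality directly and one quarter through (a/8) |z 1|^2, so \<open>a / 2\<close> survives.
    \<open>M1\<close> and \<open>M2\<close> are the resulting Young constants for weights
    \<open>a / 4\<close> and \<open>a / 8\<close>; \<open>M3\<close> comes from converting |z 1|^2
    into |z 2|^2.\<close>
  define M1 where "M1 = (C1 + C3)\<^sup>2 / a"
  define M2 where "M2 = 2 * C2\<^sup>2 / a"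
  define M3 where "M3 = a * C5\<^sup>2 / 32"
  define M where "M = M1 + M2 + M3 + C4"
  have M: "M \<ge> 0" using a C4(1) by (simp add: M_def M1_def M2_def M3_def)
  have "(norm (z 2 y))\<^sup>2 \<le> 2 / a * (sgn \<alpha> * W' y + a / 8 * Y' 0 y + M * (norm (P 2 y))\<^sup>2)" for y
  proof -
    let ?p = "norm (P 2 y)" and ?z1 = "norm (z 1 y)" and ?z2 = "norm (z 2 y)"
    have sgn_le: "sgn \<alpha> * r \<le> \<bar>r\<bar>" "- (sgn \<alpha> * r) \<le> \<bar>r\<bar>" for r :: real
      by (auto simp: sgn_if)
    have sa: "sgn \<alpha> * (\<alpha> * r) = a * r" for r by (simp add: a_def sgn_if)
    have "a * ?z2\<^sup>2 = sgn \<alpha> * W' y - sgn \<alpha> * inner (P 2 y) (K (z 2 y))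
        + sgn \<alpha> * inner (B (P 2 y)) (R (j - 1) (z 1 y)) + sgn \<alpha> * inner (P 2 y) (R (j - 2) (z 2 y))
        + sgn \<alpha> * (\<alpha> * inner (R (2 * j) (P 2 y)) (P 2 y))"
      unfolding W'_def by (simp add: distrib_left right_diff_distrib sa R_symmetric)
    also have "\<dots> \<le> sgn \<alpha> * W' y + C1 * ?p * ?z2 + C2 * ?p * ?z1 + C3 * ?p * ?z2 + C4 * ?p * ?p"
      by (intro add_mono order_trans[OF sgn_le(1) C2(2)] order_trans[OF sgn_le(1) C3(2)]
          order_trans[OF sgn_le(1) C4(2)])
         (use order_trans[OF sgn_le(2) C1(2), of "P 2 y" "z 2 y"] in simp)
    finally have 1: "a * ?z2\<^sup>2 \<le> sgn \<alpha> * W' y + ?z2 * ((C1 + C3) * ?p) + ?z1 * (C2 * ?p) + C4 * ?p\<^sup>2"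
      by (simp add: algebra_simps power2_eq_square)
    have 2: "?z2 * ((C1 + C3) * ?p) \<le> a / 4 * ?z2\<^sup>2 + M1 * ?p\<^sup>2"
      using young_le[of "a / 4" ?z2 "(C1 + C3) * ?p"] a by (simp add: M1_def power_mult_distrib)
    have 3: "?z1 * (C2 * ?p) \<le> a / 8 * ?z1\<^sup>2 + M2 * ?p\<^sup>2"
      using young_le[of "a / 8" ?z1 "C2 * ?p"] a by (simp add: M2_def power_mult_distrib)
    have "?z1\<^sup>2 \<le> Y' 0 y + ?z2\<^sup>2 + C5 * ?p * ?z2"
      using C5(2)[of "P 2 y" "z 2 y"] by (simp add: Y'_def numeral_2_eq_2 abs_le_iff)
    also have "C5 * ?p * ?z2 \<le> ?z2\<^sup>2 + C5\<^sup>2 / 4 * ?p\<^sup>2"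
      using young_le[of 1 ?z2 "C5 * ?p"] by (simp add: power_mult_distrib mult_ac)
    finally have "a / 8 * ?z1\<^sup>2 \<le> a / 8 * (Y' 0 y + ?z2\<^sup>2 + (?z2\<^sup>2 + C5\<^sup>2 / 4 * ?p\<^sup>2))"
      using a by (intro mult_left_mono) auto
    then have 4: "a / 8 * ?z1\<^sup>2 \<le> a / 8 * Y' 0 y + a / 4 * ?z2\<^sup>2 + M3 * ?p\<^sup>2"
      by (simp add: M3_def algebra_simps)
    have 5: "M * ?p\<^sup>2 = M1 * ?p\<^sup>2 + M2 * ?p\<^sup>2 + M3 * ?p\<^sup>2 + C4 * ?p\<^sup>2"
      by (simp add: M_def distrib_right)
    have "a / 2 * ?z2\<^sup>2 \<le> sgn \<alpha> * W' y + a / 8 * Y' 0 y + M * ?p\<^sup>2"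
      using 1 2 3 4 5 by linarith
    then show ?thesis using a by (simp add: field_simps)
  qed
  moreover have "controlled (\<lambda>y. 2 / a * (sgn \<alpha> * W' y + a / 8 * Y' 0 y + M * (norm (P 2 y))\<^sup>2))"
    using a M by (intro controlled_cmult controlled_add controlled_P
        controlled_flow_deriv[OF flow_deriv_W S_bounded_W]
        controlled_flow_deriv[OF flow_deriv_Y S_bounded_Y]) auto
  ultimately show ?thesis by (rule controlled_mono[rotated])
qed

lemma controlled_z: "k \<le> j \<Longrightarrow> controlled (\<lambda>y. (norm (z (k + 2) y))\<^sup>2)"
proof (induction k)
  case 0
  then show ?case using controlled_z2 by (simp add: numeral_2_eq_2)
next
  case (Suc k)
  then show ?case using controlled_z_step[of "Suc k"] by simp
qed

text \<open>Along the flow the derivative of \<open>G w\<close> is \<open>w\<close>, so the left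
  side is half the rate of \<open>E (G w)\<close>. The two equations cancel the conservative and
  coupling terms and leave the damping.\<close>

lemma energy_rate:
  "inner (a_of w) (a_of (G w)) + inner (p_of w) (p_of (G w)) + inner (b_of w) (b_of (G w))
     + inner (q_of w) (q_of (G w))
     + \<alpha> * (inner (R1 (a_of w)) (R2 (b_of (G w))) + inner (R1 (a_of (G w))) (R2 (b_of w)))
   = - inner (B (p_of (G w))) (p_of (G w))"
proof -
  have "inner (a_of w) (a_of (G w)) = - inner (p_of (G w)) (p_of w + B (p_of (G w)) + \<alpha> *\<^sub>R R2 (b_of (G w)))"
    by (subst G_components(3)) (simp add: G_components(1) R1_symmetric)
  moreover have "inner (b_of w) (b_of (G w)) = - inner (q_of (G w)) (q_of w + \<alpha> *\<^sub>R R1 (a_of (G w)))"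
    by (subst G_components(4)) (simp add: G_components(2) R2_symmetric)
  ultimately show ?thesis
    by (simp add: inner_add_right inner_commute G_components(1,2)[symmetric] algebra_simps)
qed

lemma flow_deriv_E:
  assumes "m = Suc m'"
  shows "flow_deriv (\<lambda>y. E ((G ^^ m) y)) (\<lambda>y. - 2 * inner (B (P m y)) (P m y))"
proof -
  have lin: "bounded_linear (\<lambda>x :: 'a state. a_of x)" "bounded_linear (\<lambda>x :: 'a state. b_of x)"
    "bounded_linear (\<lambda>x. R1 (a_of x))" "bounded_linear (\<lambda>x. R2 (b_of x))"
    by (intro linear_intros)+
  let ?f = "\<lambda>f g y. inner (f ((G ^^ m') y)) (g ((G ^^ m) y)) + inner (f ((G ^^ m) y)) (g ((G ^^ m') y))"
  have "flow_deriv (\<lambda>y. E ((G ^^ m) y)) (\<lambda>y. ?f a_of a_of y + ?f p_of p_of y + ?f b_of b_of y + ?f q_of q_of y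
      + (2 * \<alpha>) * ?f (\<lambda>x. R1 (a_of x)) (\<lambda>x. R2 (b_of x)) y)"
    unfolding E_def norm_state power2_norm_eq_inner
    by (intro flow_deriv_add flow_deriv_cmult flow_deriv_inner lin linear_p linear_q assms)
  moreover have "?f a_of a_of y + ?f p_of p_of y + ?f b_of b_of y + ?f q_of q_of y
      + (2 * \<alpha>) * ?f (\<lambda>x. R1 (a_of x)) (\<lambda>x. R2 (b_of x)) y = - 2 * inner (B (P m y)) (P m y)" for y
    using energy_rate[of "(G ^^ m') y"] by (simp add: assms P_def inner_commute algebra_simps)
  ultimately show ?thesis by simp
qed

lemma dissipation_nonneg: "0 \<le> inner (B x) x"
  using coercive_B[of x] beta_pos by (meson less_imp_le mult_nonneg_nonneg order_trans zero_le_power2)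

text \<open>The left side is the derivative of <u', u> + <v', v> at the state \<open>G w\<close>.
  The equations convert u'' and v'' into potential energy, which is then written as \<open>E\<close>
  minus the kinetic part.\<close>

lemma multiplier_rate:
  "inner (p_of w) (R1 (a_of (G w))) + (norm (p_of (G w)))\<^sup>2 + inner (q_of w) (R2 (b_of (G w))) + (norm (q_of (G w)))\<^sup>2
   = 2 * (norm (p_of (G w)))\<^sup>2 + 2 * (norm (q_of (G w)))\<^sup>2 - E (G w) - inner (B (p_of (G w))) (R1 (a_of (G w)))"
proof -
  have "inner (p_of w + B (p_of (G w)) + \<alpha> *\<^sub>R R2 (b_of (G w))) (R1 (a_of (G w)))
      = inner (R1 (p_of w + B (p_of (G w)) + \<alpha> *\<^sub>R R2 (b_of (G w)))) (a_of (G w))"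
    by (simp add: R1_symmetric)
  also have "R1 (p_of w + B (p_of (G w)) + \<alpha> *\<^sub>R R2 (b_of (G w))) = - a_of (G w)"
    by (subst G_components(3)) simp
  finally have 1: "inner (p_of w + B (p_of (G w)) + \<alpha> *\<^sub>R R2 (b_of (G w))) (R1 (a_of (G w)))
      = - (norm (a_of (G w)))\<^sup>2" by (simp add: power2_norm_eq_inner)
  have "inner (q_of w + \<alpha> *\<^sub>R R1 (a_of (G w))) (R2 (b_of (G w)))
      = inner (R2 (q_of w + \<alpha> *\<^sub>R R1 (a_of (G w)))) (b_of (G w))"
    by (simp add: R2_symmetric)
  also have "R2 (q_of w + \<alpha> *\<^sub>R R1 (a_of (G w))) = - b_of (G w)"
    by (subst G_components(4)) simp
  finally have 2: "inner (q_of w + \<alpha> *\<^sub>R R1 (a_of (G w))) (R2 (b_of (G w))) = - (norm (b_of (G w)))\<^sup>2"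
    by (simp add: power2_norm_eq_inner)
  show ?thesis
    using 1 2 unfolding E_def norm_state
    by (simp add: inner_add_left inner_commute[of "R2 (b_of (G w))" "R1 (a_of (G w))"])
qed

lemma controlled_E: "controlled (\<lambda>y. E ((G ^^ (j + 2)) y))"
proof -
  define X where "X y = inner (P (j + 2) y) (R1 (a_of ((G ^^ (j + 2)) y)))
      + inner (Q (j + 2) y) (R2 (b_of ((G ^^ (j + 2)) y)))" for y
  define X' where "X' y = 2 * (norm (P (j + 2) y))\<^sup>2 + 2 * (norm (Q (j + 2) y))\<^sup>2
    - E ((G ^^ (j + 2)) y) - inner (B (P (j + 2) y)) (R1 (a_of ((G ^^ (j + 2)) y)))" for y
  have lin: "bounded_linear (\<lambda>x. R1 (a_of x))" "bounded_linear (\<lambda>x. R2 (b_of x))" 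
    by (intro linear_intros)+
  have S_bounded_X: "S_bounded X"
    unfolding X_def[abs_def] P_def Q_def by (intro S_bounded_add S_bounded_inner lin linear_p linear_q) auto
  have "flow_deriv X (\<lambda>y. (inner (p_of ((G ^^ (j + 1)) y)) (R1 (a_of ((G ^^ (j + 2)) y)))
        + inner (p_of ((G ^^ (j + 2)) y)) (R1 (a_of ((G ^^ (j + 1)) y))))
      + (inner (q_of ((G ^^ (j + 1)) y)) (R2 (b_of ((G ^^ (j + 2)) y)))
        + inner (q_of ((G ^^ (j + 2)) y)) (R2 (b_of ((G ^^ (j + 1)) y)))))"
    unfolding X_def[abs_def] P_def Q_def
    by (intro flow_deriv_add flow_deriv_inner lin linear_p linear_q) auto
  moreover have "(inner (p_of ((G ^^ (j + 1)) y)) (R1 (a_of ((G ^^ (j + 2)) y)))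
        + inner (p_of ((G ^^ (j + 2)) y)) (R1 (a_of ((G ^^ (j + 1)) y))))
      + (inner (q_of ((G ^^ (j + 1)) y)) (R2 (b_of ((G ^^ (j + 2)) y)))
        + inner (q_of ((G ^^ (j + 2)) y)) (R2 (b_of ((G ^^ (j + 1)) y)))) = X' y" for y
    using multiplier_rate[of "(G ^^ (j + 1)) y"]
    by (simp add: X'_def P_def Q_def power2_norm_eq_inner G_components(1,2)[symmetric])
  ultimately have flow_X: "flow_deriv X X'" by simp
  obtain C where C: "C \<ge> 0" "\<And>x y. \<bar>inner (B x) (R1 y)\<bar> \<le> C * norm x * norm y"
    using abs_inner_bounded_linear[OF linear_B linear_R1] by blast
  \<comment> \<open>The multiplier identity solved for \<open>E\<close>. Estimating the damping term
    returns \<open>E / 2\<close>, hence the doubled coefficients; the divisor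
    \<open>1 - \<rho>\<close> is the coercivity constant of \<open>E\<close>.\<close>
  have "E ((G ^^ (j + 2)) y) \<le> (4 + C\<^sup>2 / (1 - \<rho>)) * (norm (P (j + 2) y))\<^sup>2 + 4 * (norm (z (j + 2) y))\<^sup>2
      + (- 2) * X' y" for y
  proof -
    let ?x = "(G ^^ (j + 2)) y"
    have "- inner (B (P (j + 2) y)) (R1 (a_of ?x)) \<le> norm (a_of ?x) * (C * norm (P (j + 2) y))"
      using C(2)[of "P (j + 2) y" "a_of ?x"] by (simp add: mult_ac abs_le_iff)
    also have "\<dots> \<le> (1 - \<rho>) / 2 * (norm (a_of ?x))\<^sup>2 + C\<^sup>2 / (2 * (1 - \<rho>)) * (norm (P (j + 2) y))\<^sup>2"
    proof -
      have pos: "(1 - \<rho>) / 2 > 0" using rho_bounds by simp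
      have gen: "1 / (4 * (c / 2)) * (C * p)\<^sup>2 = C\<^sup>2 / (2 * c) * p\<^sup>2" for c p :: real
        by (simp add: power_mult_distrib)
      have "1 / (4 * ((1 - \<rho>) / 2)) * (C * norm (P (j + 2) y))\<^sup>2 = C\<^sup>2 / (2 * (1 - \<rho>)) * (norm (P (j + 2) y))\<^sup>2"
        by (rule gen)
      then show ?thesis
        using young_le[OF pos, of "norm (a_of ?x)" "C * norm (P (j + 2) y)"] by (simp only:)
    qed
    also have "(1 - \<rho>) / 2 * (norm (a_of ?x))\<^sup>2 \<le> E ?x / 2"
    proof -
      have "(1 - \<rho>) * (norm (a_of ?x))\<^sup>2 \<le> (1 - \<rho>) * (norm ?x)\<^sup>2"
        using rho_bounds by (intro mult_left_mono power_mono norm_components) auto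
      then show ?thesis using E_ge[of ?x] by simp
    qed
    finally have 1: "- inner (B (P (j + 2) y)) (R1 (a_of ?x))
        \<le> E ?x / 2 + C\<^sup>2 / (2 * (1 - \<rho>)) * (norm (P (j + 2) y))\<^sup>2" by simp
    have "C\<^sup>2 / c * r = 2 * (C\<^sup>2 / (2 * c) * r)" for c r :: real by simp
    from this[of "1 - \<rho>"]
    have 2: "C\<^sup>2 / (1 - \<rho>) * r = 2 * (C\<^sup>2 / (2 * (1 - \<rho>)) * r)" for r .
    have 3: "z (j + 2) y = Q (j + 2) y" by (simp add: z_def R_def)
    show ?thesis unfolding distrib_right 2 3 using 1 unfolding X'_def by argo
  qed
  moreover have "controlled (\<lambda>y. (4 + C\<^sup>2 / (1 - \<rho>)) * (norm (P (j + 2) y))\<^sup>2 + 4 * (norm (z (j + 2) y))\<^sup>2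
      + (- 2) * X' y)"
    using rho_bounds by (intro controlled_add controlled_P controlled_cmult controlled_z
        controlled_flow_deriv[OF flow_X S_bounded_X]) auto
  ultimately show ?thesis by (rule controlled_mono[rotated])
qed

lemma E_G_decreasing:
  assumes "m \<ge> 1" "0 \<le> s" "s \<le> t"
  shows "E ((G ^^ m) (T t y)) \<le> E ((G ^^ m) (T s y))"
proof (rule decreasing_of_derivative_nonpos[where f = "\<lambda>t. E ((G ^^ m) (T t y))"
      and f' = "\<lambda>t. - 2 * inner (B (P m (T t y))) (P m (T t y))"])
  have "flow_deriv (\<lambda>y. E ((G ^^ m) y)) (\<lambda>y. - 2 * inner (B (P m y)) (P m y))"
    using assms by (intro flow_deriv_E[of m "m - 1"]) auto
  then show "((\<lambda>t. E ((G ^^ m) (T t y))) has_real_derivative - 2 * inner (B (P m (T r y))) (P m (T r y)))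
      (at r within {0..})" if "s \<le> r" "r \<le> t" for r
    using that assms by (simp add: flow_deriv_def)
qed (use assms dissipation_nonneg in auto)

text \<open>\<open>L = M * S - F\<close> is the Lyapunov functional: its derivative is at most minus
  the energy, and it lies between 0 and \<open>2 * M * S\<close>.\<close>

lemma energy_decay_smooth:
  "\<exists>C\<ge>0. \<forall>t>0. \<forall>y. t * E (T t ((G ^^ (j + 2)) y)) \<le> C * S y"
proof -
  let ?e = "\<lambda>y. E ((G ^^ (j + 2)) y)"
  obtain C F F' where C: "C \<ge> 0" and F: "flow_deriv F F'" "S_bounded F" and e_le: "\<And>y. ?e y \<le> C * D y + F' y"
    using controlled_E unfolding controlled_def by blast
  obtain C' where C': "\<And>y. \<bar>F y\<bar> \<le> C' * S y" using F(2) unfolding S_bounded_def by blast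
  \<comment> \<open>Two demands are met: \<open>M\<close> dominates the bound on \<open>F\<close>,
    and \<open>2 * \<beta> * M\<close> dominates \<open>C\<close>, so that the dissipation in
    \<open>M * S'\<close> swallows \<open>C * D\<close>.\<close>
  define M where "M = \<bar>C'\<bar> + C / (2 * \<beta>)"
  have M_ge: "\<bar>C'\<bar> \<le> M" and M_C: "C \<le> 2 * \<beta> * M"
    using C beta_pos by (auto simp: M_def field_simps)
  define S' where "S' y = (\<Sum>m=2..j + 2. - 2 * inner (B (P m y)) (P m y))" for y
  have S: "flow_deriv S S'"
    unfolding S_def[abs_def] S'_def[abs_def]
  proof (rule flow_deriv_sum)
    fix m assume "m \<in> {2..j + 2}"
    then show "flow_deriv (\<lambda>y. E ((G ^^ m) y)) (\<lambda>y. - 2 * inner (B (P m y)) (P m y))"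
      by (intro flow_deriv_E[of m "m - 1"]) auto
  qed
  have S'_le: "S' y \<le> - 2 * \<beta> * D y" for y
    unfolding S'_def D_def sum_distrib_left by (intro sum_mono) (use coercive_B in \<open>simp add: mult.assoc\<close>)
  define L where "L y = M * S y + (- 1) * F y" for y
  define L' where "L' y = M * S' y + (- 1) * F' y" for y
  have L: "flow_deriv L L'"
    unfolding L_def[abs_def] L'_def[abs_def] by (intro flow_deriv_add flow_deriv_cmult S F)
  have L'_le: "L' y \<le> - ?e y" for y
  proof -
    have "M * S' y \<le> M * (- 2 * \<beta> * D y)" using M_ge S'_le by (intro mult_left_mono) auto
    also have "\<dots> \<le> - C * D y" using mult_right_mono[OF M_C D_nonneg, of y] by (simp add: algebra_simps)
    finally show ?thesis using e_le[of y] by (simp add: L'_def)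
  qed
  have CS: "\<bar>F y\<bar> \<le> M * S y" for y
    using C'[of y] mult_right_mono[OF order_trans[OF abs_ge_self M_ge] S_nonneg, of y] by linarith
  have "t * E (T t ((G ^^ (j + 2)) y)) \<le> (2 * M) * S y" if t: "t > 0" for t y
  proof -
    \<comment> \<open>The energy at the final time is held constant. As the energy does not
      increase, it is at most the energy at each \<open>s\<close>, so the sum decreases in
      \<open>s\<close>; this replaces integrating the energy.\<close>
    have "L (T t y) + t * ?e (T t y) \<le> L (T 0 y) + 0 * ?e (T t y)"
    proof (rule decreasing_of_derivative_nonpos[where f = "\<lambda>s. L (T s y) + s * ?e (T t y)"
          and f' = "\<lambda>s. L' (T s y) + ?e (T t y)"])
      show "((\<lambda>s. L (T s y) + s * ?e (T t y)) has_real_derivative L' (T s y) + ?e (T t y)) (at s within {0..})"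
        if "0 \<le> s" for s
        using L that unfolding flow_deriv_def by (auto intro!: derivative_eq_intros)
      show "L' (T s y) + ?e (T t y) \<le> 0" if "0 \<le> s" "s \<le> t" for s
        using L'_le[of "T s y"] E_G_decreasing[of "j + 2" s t y] that by simp
    qed (use t in auto)
    moreover have "0 \<le> L (T t y)" "L y \<le> 2 * M * S y"
      using CS[of "T t y"] CS[of y] by (auto simp: L_def)
    moreover have "T t ((G ^^ (j + 2)) y) = (G ^^ (j + 2)) (T t y)"
      using t by (intro T_G_pow_commute) simp
    ultimately show ?thesis by (simp only: T_zero)
  qed
  then show ?thesis using M_ge by (intro exI[of _ "2 * M"]) auto
qed

end

section \<open>Extension by density and iteration of the decay\<close>

locale coupled_semigroup_dense = coupled_semigroup +
  assumes dense_G: "closure (range G) = UNIV"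
begin

lemma continuous_G_pow: "continuous_on UNIV (G ^^ m)"
  by (intro linear_continuous_on bounded_linear_funpow bounded_linear_G)

lemma dense_G_pow: "closure (range (G ^^ m)) = UNIV"
proof (induction m)
  case (Suc m)
  have "G ` closure (range (G ^^ m)) \<subseteq> closure (G ` range (G ^^ m))"
    by (intro image_closure_subset linear_continuous_on bounded_linear_G closure_subset) simp
  then have "range G \<subseteq> closure (range (G ^^ Suc m))"
    using Suc by (simp add: image_comp)
  then have "closure (range G) \<subseteq> closure (range (G ^^ Suc m))" by (rule closure_minimal) simp
  then show ?case using dense_G by auto
qed simp

lemma extend_inequality:
  assumes "\<And>y. F ((G ^^ m) y) \<le> H ((G ^^ m) y)" "continuous_on UNIV F" "continuous_on UNIV H"
  shows "F w \<le> (H w :: real)"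
proof -
  have "closed {w. F w \<le> H w}" using assms(2,3) by (rule closed_Collect_le)
  moreover have "range (G ^^ m) \<subseteq> {w. F w \<le> H w}" using assms(1) by auto
  ultimately have "closure (range (G ^^ m)) \<subseteq> {w. F w \<le> H w}" by (rule closure_minimal[rotated])
  then show ?thesis using dense_G_pow by auto
qed

lemma continuous_E_compose: "continuous_on UNIV f \<Longrightarrow> continuous_on UNIV (\<lambda>x. E (f x))"
  by (rule continuous_on_compose2[OF continuous_E]) auto

lemma E_contraction:
  assumes "t \<ge> 0"
  shows "E (T t w) \<le> E w"
proof (rule extend_inequality[where m = 1 and F = "\<lambda>w. E (T t w)"])
  show "E (T t ((G ^^ 1) y)) \<le> E ((G ^^ 1) y)" for y
    using E_G_decreasing[of 1 0 t y] assms by (simp add: T_G_commute T_zero)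
  show "continuous_on UNIV (\<lambda>w. E (T t w))"
    by (intro continuous_E_compose linear_continuous_on bounded_linear_T assms)
qed (rule continuous_E)

text \<open>Writing \<open>w\<close> for \<open>(G ^^ 2) y\<close> removes the two extra
  derivatives: both sides are then continuous in \<open>w\<close>, and such \<open>w\<close> are
  dense.\<close>

lemma energy_decay_once:
  "\<exists>C\<ge>0. \<forall>t>0. \<forall>w. t * E (T t ((G ^^ j) w)) \<le> C * (\<Sum>m\<le>j. E ((G ^^ m) w))"
proof -
  obtain C where C: "C \<ge> 0" "\<And>t y. t > 0 \<Longrightarrow> t * E (T t ((G ^^ (j + 2)) y)) \<le> C * S y"
    using energy_decay_smooth by blast
  have S_eq: "S y = (\<Sum>m\<le>j. E ((G ^^ m) ((G ^^ 2) y)))" for y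
  proof -
    have "S y = (\<Sum>m=0+2..j + 2. E ((G ^^ m) y))" unfolding S_def by (simp only: add_0)
    also have "\<dots> = (\<Sum>m=0..j. E ((G ^^ (m + 2)) y))" by (rule sum.shift_bounds_cl_nat_ivl)
    finally show ?thesis by (simp only: funpow_add o_apply atMost_atLeast0)
  qed
  have "t * E (T t ((G ^^ j) w)) \<le> C * (\<Sum>m\<le>j. E ((G ^^ m) w))" if t: "t > 0" for t w
  proof (rule extend_inequality[where m = 2 and F = "\<lambda>w. t * E (T t ((G ^^ j) w))"])
    show "t * E (T t ((G ^^ j) ((G ^^ 2) y))) \<le> C * (\<Sum>m\<le>j. E ((G ^^ m) ((G ^^ 2) y)))" for y
      using C(2)[OF t, of y] by (simp only: S_eq funpow_add o_apply)
    show "continuous_on UNIV (\<lambda>w. t * E (T t ((G ^^ j) w)))"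
      using t by (intro continuous_intros continuous_E_compose linear_continuous_on
          bounded_linear_compose[OF bounded_linear_T] bounded_linear_funpow bounded_linear_G) auto
    show "continuous_on UNIV (\<lambda>w. C * (\<Sum>m\<le>j. E ((G ^^ m) w)))"
      by (intro continuous_intros continuous_E_compose continuous_G_pow)
  qed
  then show ?thesis using C(1) by blast
qed

text \<open>The time is halved. On one half the decay for \<open>j\<close> derivatives leaves
  energies of \<open>(G ^^ m) w\<close> after \<open>n\<close> rounds, and the induction hypothesis
  for these data covers the other half. The factor \<open>2 ^ Suc n\<close> comes from the halving,
  \<open>1 + j\<close> from the number of summands.\<close>

lemma energy_decay:
  "\<exists>C\<ge>0. \<forall>t>0. \<forall>w. t ^ n * E (T t ((G ^^ (n * j)) w)) \<le> C * (\<Sum>m\<le>n * j. E ((G ^^ m) w))"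
proof (induction n)
  case 0
  then show ?case using E_contraction by (intro exI[of _ 1]) auto
next
  case (Suc n)
  obtain C where C: "C \<ge> 0"
    "\<And>t w. t > 0 \<Longrightarrow> t ^ n * E (T t ((G ^^ (n * j)) w)) \<le> C * (\<Sum>m\<le>n * j. E ((G ^^ m) w))"
    using Suc by blast
  obtain C1 where C1: "C1 \<ge> 0"
    "\<And>t w. t > 0 \<Longrightarrow> t * E (T t ((G ^^ j) w)) \<le> C1 * (\<Sum>m\<le>j. E ((G ^^ m) w))"
    using energy_decay_once by blast
  have "t ^ Suc n * E (T t ((G ^^ (Suc n * j)) w))
      \<le> (2 ^ Suc n * C1 * (1 + real j) * C) * (\<Sum>m\<le>Suc n * j. E ((G ^^ m) w))" (is "_ \<le> _ * ?\<Sigma>")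
    if t: "t > 0" for t w
  proof -
    define s where "s = t / 2"
    have s: "s > 0" and ts: "t = s + s" using t by (auto simp: s_def)
    have Tt: "T t x = T s (T s x)" for x
      unfolding ts using s by (intro T_add) auto
    have "T t ((G ^^ (Suc n * j)) w) = T s ((G ^^ j) (T s ((G ^^ (n * j)) w)))"
      using s by (simp add: Tt funpow_add T_G_pow_commute)
    then have "s ^ Suc n * E (T t ((G ^^ (Suc n * j)) w))
        = s ^ n * (s * E (T s ((G ^^ j) (T s ((G ^^ (n * j)) w)))))" by simp
    also have "\<dots> \<le> s ^ n * (C1 * (\<Sum>m\<le>j. E ((G ^^ m) (T s ((G ^^ (n * j)) w)))))"
      using s by (intro mult_left_mono C1) auto
    also have "\<dots> = C1 * (\<Sum>m\<le>j. s ^ n * E (T s ((G ^^ (n * j)) ((G ^^ m) w))))"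
    proof -
      have "(G ^^ m) (T s ((G ^^ (n * j)) w)) = T s ((G ^^ (n * j)) ((G ^^ m) w))" for m
      proof -
        have "(G ^^ m) ((G ^^ (n * j)) x) = (G ^^ (n * j)) ((G ^^ m) x)" for x
          using funpow_add[of m "n * j" G] funpow_add[of "n * j" m G]
          by (simp add: add.commute fun_eq_iff)
        then show ?thesis using s by (simp add: T_G_pow_commute)
      qed
      then show ?thesis by (simp add: sum_distrib_left mult_ac)
    qed
    also have "\<dots> \<le> C1 * (\<Sum>m\<le>j. C * ?\<Sigma>)"
    proof (intro mult_left_mono sum_mono C1(1))
      fix m assume m: "m \<in> {..j}"
      have "s ^ n * E (T s ((G ^^ (n * j)) ((G ^^ m) w))) \<le> C * (\<Sum>i\<le>n * j. E ((G ^^ i) ((G ^^ m) w)))"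
        by (rule C(2)[OF s])
      also have "(\<Sum>i\<le>n * j. E ((G ^^ i) ((G ^^ m) w))) = (\<Sum>i\<in>(\<lambda>i. i + m) ` {..n * j}. E ((G ^^ i) w))"
        by (subst sum.reindex) (auto simp: funpow_add inj_on_def)
      also have "\<dots> \<le> ?\<Sigma>" using m by (intro sum_mono2) (auto simp: E_nonneg)
      finally show "s ^ n * E (T s ((G ^^ (n * j)) ((G ^^ m) w))) \<le> C * ?\<Sigma>"
        using C(1) by (simp add: mult_left_mono)
    qed
    finally have "2 ^ Suc n * (s ^ Suc n * E (T t ((G ^^ (Suc n * j)) w)))
        \<le> 2 ^ Suc n * (C1 * (\<Sum>m\<le>j. C * ?\<Sigma>))"
      by (rule mult_left_mono) simp
    then show ?thesis by (simp add: s_def power_divide mult_ac)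
  qed
  then show ?case using C(1) C1(1) by (intro exI[of _ "2 ^ Suc n * C1 * (1 + real j) * C"]) auto
qed

end

section \<open>Coercive self-adjoint operators and the K-functional\<close>

lemma parallelogram_law:
  fixes x y :: "'a::real_inner"
  shows "(norm (x + y))\<^sup>2 + (norm (x - y))\<^sup>2 = 2 * (norm x)\<^sup>2 + 2 * (norm y)\<^sup>2"
  by (simp add: power2_norm_eq_inner algebra_simps inner_commute)

lemma orthogonal_projection:
  fixes M :: "'a::{real_inner,complete_space} set"
  assumes "subspace M" "closed M"
  shows "\<exists>m\<in>M. \<forall>y\<in>M. inner (x - m) y = 0"
proof -
  define d where "d = infdist x M"
  have ne: "M \<noteq> {}" using assms(1) subspace_0 by blast
  have d_le: "d \<le> norm (x - y)" if "y \<in> M" for y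
    using infdist_le[OF that, of x] by (simp add: d_def dist_norm)
  have d0: "d \<ge> 0" by (simp add: d_def infdist_nonneg)
  have "\<exists>m\<in>M. (norm (x - m))\<^sup>2 < d\<^sup>2 + 1 / (real n + 1)" for n :: nat
  proof -
    have "d < sqrt (d\<^sup>2 + 1 / (real n + 1))" using d0 by (intro real_less_rsqrt) simp
    then have "\<not> (\<forall>m\<in>M. sqrt (d\<^sup>2 + 1 / (real n + 1)) \<le> dist x m)"
      unfolding d_def infdist_notempty[OF ne] using cINF_greatest[OF ne] by (meson leD)
    then obtain m where "m \<in> M" "dist x m < sqrt (d\<^sup>2 + 1 / (real n + 1))"
      by (meson not_le)
    moreover have "(norm (x - m))\<^sup>2 < (sqrt (d\<^sup>2 + 1 / (real n + 1)))\<^sup>2"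
      using calculation by (intro power_strict_mono) (auto simp: dist_norm)
    ultimately show ?thesis by (intro bexI[of _ m]) simp_all
  qed
  then obtain m where m: "\<And>n. m n \<in> M" "\<And>n. (norm (x - m n))\<^sup>2 < d\<^sup>2 + 1 / (real n + 1)"
    by metis
  have close: "(norm (m n - m k))\<^sup>2 \<le> 2 / (real n + 1) + 2 / (real k + 1)" for n k
  proof -
    let ?h = "(1 / 2) *\<^sub>R (m n + m k)"
    have "?h \<in> M" using assms(1) m(1) by (intro subspace_scale subspace_add)
    then have "d\<^sup>2 \<le> (norm (x - ?h))\<^sup>2" using d_le d0 by (intro power_mono)
    moreover have "(norm ((x - m n) + (x - m k)))\<^sup>2 = 4 * (norm (x - ?h))\<^sup>2"
    proof -
      have "(x - m n) + (x - m k) = 2 *\<^sub>R (x - ?h)" by (simp add: scaleR_2 algebra_simps)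
      then show ?thesis by (simp add: power_mult_distrib)
    qed
    moreover have "norm ((x - m n) - (x - m k)) = norm (m n - m k)"
      by (simp add: norm_minus_commute)
    ultimately show ?thesis
      using parallelogram_law[of "x - m n" "x - m k"] m(2)[of n] m(2)[of k] by simp
  qed
  have "Cauchy m"
    unfolding Cauchy_altdef2
  proof (intro allI impI)
    fix e :: real assume e: "e > 0"
    obtain N :: nat where N: "4 / e\<^sup>2 < real N" using reals_Archimedean2 by blast
    have "dist (m n) (m N) < e" if "n \<ge> N" for n
    proof -
      have "4 < real N * e\<^sup>2" using N e by (simp add: field_simps)
      also have "\<dots> \<le> e\<^sup>2 * (real N + 1)" by (simp add: algebra_simps)
      finally have "4 / (real N + 1) < e\<^sup>2" by (simp add: divide_less_eq)
      moreover have "2 / (real n + 1) \<le> 2 / (real N + 1)" using that by (intro divide_left_mono) auto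
      ultimately have "(norm (m n - m N))\<^sup>2 < e\<^sup>2" using close[of n N] by simp
      then show ?thesis using e by (simp add: dist_norm power_less_imp_less_base)
    qed
    then show "\<exists>N. \<forall>n\<ge>N. dist (m n) (m N) < e" by blast
  qed
  then obtain l where l: "m \<longlonglongrightarrow> l" using Cauchy_convergent_iff convergent_def by blast
  have lM: "l \<in> M" using closed_sequentially[OF assms(2) _ l] m(1) by blast
  have "(\<lambda>n. 1 / (real n + 1)) \<longlonglongrightarrow> 0"
    using LIMSEQ_inverse_real_of_nat by (simp add: inverse_eq_divide add.commute)
  then have "(\<lambda>n. d\<^sup>2 + 1 / (real n + 1)) \<longlonglongrightarrow> d\<^sup>2 + 0"
    by (intro tendsto_add tendsto_const)
  moreover have "(\<lambda>n. (norm (x - m n))\<^sup>2) \<longlonglongrightarrow> (norm (x - l))\<^sup>2"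
    by (intro tendsto_intros l)
  ultimately have min: "(norm (x - l))\<^sup>2 \<le> d\<^sup>2"
    using m(2) by (intro LIMSEQ_le[of "\<lambda>n. (norm (x - m n))\<^sup>2"]) (auto intro!: exI[of _ 0] less_imp_le)
  have "inner (x - l) y = 0" if y: "y \<in> M" for y
  proof (cases "y = 0")
    case False
    define t where "t = inner (x - l) y / (norm y)\<^sup>2"
    have "l + t *\<^sub>R y \<in> M" using lM y assms(1) by (intro subspace_add subspace_scale)
    then have "d\<^sup>2 \<le> (norm (x - (l + t *\<^sub>R y)))\<^sup>2" using d_le d0 by (intro power_mono)
    also have "x - (l + t *\<^sub>R y) = (x - l) - t *\<^sub>R y" by simp
    also have "(norm ((x - l) - t *\<^sub>R y))\<^sup>2 = (norm (x - l))\<^sup>2 - 2 * t * inner (x - l) y + t\<^sup>2 * (norm y)\<^sup>2"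
      by (simp only: power2_norm_eq_inner inner_diff_left inner_diff_right inner_scaleR_left inner_scaleR_right
          inner_commute[of y "x - l"]) (simp add: power2_eq_square inner_commute algebra_simps)
    also have "\<dots> = (norm (x - l))\<^sup>2 - (inner (x - l) y)\<^sup>2 / (norm y)\<^sup>2"
      using False by (simp add: t_def power2_eq_square field_simps)
    finally have "(inner (x - l) y)\<^sup>2 / (norm y)\<^sup>2 \<le> 0" using min by simp
    then show ?thesis using False by (simp add: divide_le_0_iff)
  qed simp
  then show ?thesis using lM by blast
qed

lemma linear_on_dom_diff:
  assumes "linear_on_dom D A" "x \<in> D" "y \<in> D"
  shows "x - y \<in> D" "A (x - y) = A x - A y"
proof -
  have s: "subspace D" using assms(1) by (simp add: linear_on_dom_def)
  have y: "- y \<in> D" using subspace_neg[OF s assms(3)] .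
  show "x - y \<in> D" using subspace_diff[OF s assms(2,3)] .
  have "A (- y) = - A y" using assms unfolding linear_on_dom_def by (metis scaleR_minus1_left)
  then show "A (x - y) = A x - A y" using assms y unfolding linear_on_dom_def by (metis diff_conv_add_uminus)
qed

text \<open>Coercivity and the closed graph make the range closed. A residual orthogonal to it lies
  in \<open>D\<close> by maximality of the self-adjoint domain, and coercivity then forces it to
  vanish.\<close>

lemma selfadjoint_coercive_surj:
  fixes A :: "'a::{real_inner,complete_space} \<Rightarrow> 'a"
  assumes sa: "selfadjoint_op D A" and w: "\<omega> > 0"
    and co: "\<forall>u\<in>D. inner (A u) u \<ge> \<omega> * (norm u)\<^sup>2"
  shows "\<exists>u\<in>D. A u = f"
proof -
  have lin: "linear_on_dom D A" and sub: "subspace D" and dense: "closure D = UNIV"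
    and cl: "closed {(x, A x) | x. x \<in> D}"
    and symm: "\<And>x y. x \<in> D \<Longrightarrow> y \<in> D \<Longrightarrow> inner (A x) y = inner x (A y)"
    and max: "\<And>y z. (\<And>x. x \<in> D \<Longrightarrow> inner (A x) y = inner x z) \<Longrightarrow> y \<in> D"
    using sa unfolding selfadjoint_op_def linear_on_dom_def by blast+
  have bound: "\<omega> * norm u \<le> norm (A u)" if "u \<in> D" for u
  proof (cases "u = 0")
    case False
    have "\<omega> * (norm u)\<^sup>2 \<le> norm (A u) * norm u"
      using co that norm_cauchy_schwarz[of "A u" u] by fastforce
    then show ?thesis using False by (simp add: power2_eq_square mult.assoc[symmetric])
  qed simp
  have "subspace (A ` D)"
    unfolding subspace_def
  proof (intro conjI ballI allI)
    show "0 \<in> A ` D" using linear_on_dom_diff[OF lin, of 0 0] subspace_0[OF sub] by force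
    show "x + y \<in> A ` D" if xy: "x \<in> A ` D" "y \<in> A ` D" for x y
    proof -
      obtain u v where "u \<in> D" "v \<in> D" "x = A u" "y = A v" using xy by blast
      then show ?thesis
        using lin subspace_add[OF sub, of u v] by (intro image_eqI[of _ A "u + v"]) (auto simp: linear_on_dom_def)
    qed
    show "r *\<^sub>R x \<in> A ` D" if x: "x \<in> A ` D" for r x
    proof -
      obtain u where "u \<in> D" "x = A u" using x by blast
      then show ?thesis
        using lin subspace_scale[OF sub, of u r] by (intro image_eqI[of _ A "r *\<^sub>R u"]) (auto simp: linear_on_dom_def)
    qed
  qed
  moreover have "closed (A ` D)"
    unfolding closed_sequential_limits
  proof (intro allI impI, elim conjE)
    fix s l assume s: "\<forall>n. s n \<in> A ` D" and l: "s \<longlonglongrightarrow> l"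
    then have "\<forall>n. \<exists>v. v \<in> D \<and> s n = A v" by blast
    then obtain u where u: "\<And>n. u n \<in> D" "\<And>n. s n = A (u n)" by metis
    have "Cauchy u"
    proof (rule metric_CauchyI)
      fix e :: real assume "e > 0"
      then obtain N where N: "\<And>m n. m \<ge> N \<Longrightarrow> n \<ge> N \<Longrightarrow> dist (s m) (s n) < \<omega> * e"
        using metric_CauchyD[OF LIMSEQ_imp_Cauchy[OF l], of "\<omega> * e"] w by auto
      have "dist (u m) (u n) < e" if "m \<ge> N" "n \<ge> N" for m n
      proof -
        have "\<omega> * norm (u m - u n) \<le> norm (A (u m) - A (u n))"
          using bound[OF linear_on_dom_diff(1)[OF lin u(1) u(1)], of m n]
          by (simp only: linear_on_dom_diff(2)[OF lin u(1) u(1)])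
        also have "\<dots> < \<omega> * e" using N[OF that] by (simp add: dist_norm u(2))
        finally show ?thesis using w by (simp add: dist_norm)
      qed
      then show "\<exists>M. \<forall>m\<ge>M. \<forall>n\<ge>M. dist (u m) (u n) < e" by blast
    qed
    then obtain v where v: "u \<longlonglongrightarrow> v" using Cauchy_convergent_iff convergent_def by blast
    have lim: "(\<lambda>n. (u n, s n)) \<longlonglongrightarrow> (v, l)" by (intro tendsto_Pair v l)
    have "(u n, s n) \<in> {(x, A x) | x. x \<in> D}" for n using u by blast
    then have "(v, l) \<in> {(x, A x) | x. x \<in> D}" using closed_sequentially[OF cl _ lim] by blast
    then show "l \<in> A ` D" by auto
  qed
  ultimately obtain m where m: "m \<in> A ` D" "\<And>y. y \<in> A ` D \<Longrightarrow> inner (f - m) y = 0"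
    using orthogonal_projection[of "A ` D" f] by blast
  define r where "r = f - m"
  have r0: "inner (A x) r = 0" if "x \<in> D" for x
    using m(2)[of "A x"] that by (simp add: r_def inner_commute)
  have rD: "r \<in> D" by (rule max[of _ 0]) (simp add: r0)
  have "\<omega> * (norm r)\<^sup>2 \<le> 0" using co rD r0[OF rD] by fastforce
  then have "r = 0" using w by (simp add: mult_le_0_iff)
  then show ?thesis using m(1) by (auto simp: r_def)
qed

definition op_inverse :: "'a set \<Rightarrow> ('a \<Rightarrow> 'a) \<Rightarrow> 'a \<Rightarrow> 'a" where
  "op_inverse D S x = (THE y. y \<in> D \<and> S y = x)"

context
  fixes D DS :: "'a::{real_inner,complete_space} set" and A S :: "'a \<Rightarrow> 'a" and \<omega> :: real
  assumes sa: "selfadjoint_op D A" and w: "\<omega> > 0"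
    and co: "\<forall>u\<in>D. inner (A u) u \<ge> \<omega> * (norm u)\<^sup>2"
    and sqrt: "is_pos_sqrt D A DS S"
begin

lemma sqrt_facts:
  "linear_on_dom DS S" "subspace DS" "x \<in> DS \<Longrightarrow> y \<in> DS \<Longrightarrow> inner (S x) y = inner x (S y)"
  "x \<in> D \<longleftrightarrow> x \<in> DS \<and> S x \<in> DS" "x \<in> D \<Longrightarrow> S (S x) = A x"
  using sqrt unfolding is_pos_sqrt_def selfadjoint_op_def linear_on_dom_def by blast+

text \<open>Both halves are inherited from \<open>A\<close>: if \<open>A u = x\<close>, then
  \<open>S u\<close> is a preimage under \<open>S\<close>, and a kernel vector of \<open>S\<close>
  lies in \<open>D\<close> and is killed by \<open>A\<close>.\<close>

lemma op_inverse_ex1: "\<exists>!y. y \<in> DS \<and> S y = x"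
proof (rule ex_ex1I)
  obtain u where "u \<in> D" "A u = x" using selfadjoint_coercive_surj[OF sa w co] by blast
  then show "\<exists>y. y \<in> DS \<and> S y = x" using sqrt_facts(4,5) by metis
next
  fix y y' assume y: "y \<in> DS \<and> S y = x" "y' \<in> DS \<and> S y' = x"
  define d where "d = y - y'"
  have d: "d \<in> DS" "S d = 0"
    using linear_on_dom_diff[OF sqrt_facts(1), of y y'] y by (auto simp: d_def)
  have "S 0 = 0" using linear_on_dom_diff(2)[OF sqrt_facts(1) d(1) d(1)] by simp
  moreover have dD: "d \<in> D" using d subspace_0[OF sqrt_facts(2)] by (simp add: sqrt_facts(4))
  ultimately have "A d = 0" using sqrt_facts(5)[OF dD] d by simp
  then have "\<omega> * (norm d)\<^sup>2 \<le> 0" using co dD by fastforce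
  then show "y = y'" using w by (simp add: mult_le_0_iff d_def)
qed

lemma op_inverse: "op_inverse DS S x \<in> DS" "S (op_inverse DS S x) = x"
  unfolding op_inverse_def using theI'[OF op_inverse_ex1[of x]] by blast+

lemma op_inverse_eq: "y \<in> DS \<Longrightarrow> op_inverse DS S (S y) = y"
  using op_inverse[of "S y"] op_inverse_ex1[of "S y"] by blast

lemma op_inverse_symmetric: "inner (op_inverse DS S x) y = inner x (op_inverse DS S y)"
  using sqrt_facts(3)[OF op_inverse(1) op_inverse(1), of x y] by (simp add: op_inverse(2))

text \<open>The squared norm is <x, A^(-1) x>, and coercivity bounds the inverse of \<open>A\<close>
  by \<open>1 / \<omega>\<close>.\<close>

lemma op_inverse_le: "norm (op_inverse DS S x) \<le> 1 / sqrt \<omega> * norm x"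
proof -
  let ?R = "op_inverse DS S"
  define u where "u = ?R (?R x)"
  have uD: "u \<in> D" by (simp add: sqrt_facts(4) u_def op_inverse)
  have Au: "A u = x" using sqrt_facts(5)[OF uD] by (simp add: u_def op_inverse)
  have "\<omega> * (norm u)\<^sup>2 \<le> norm x * norm u"
    using co uD norm_cauchy_schwarz[of "A u" u] Au by fastforce
  then have u: "\<omega> * norm u \<le> norm x"
    by (cases "u = 0") (simp_all add: power2_eq_square mult.assoc[symmetric])
  have "(norm (?R x))\<^sup>2 = inner x u"
    by (simp add: power2_norm_eq_inner op_inverse_symmetric u_def)
  also have "\<dots> \<le> norm x * norm u" by (rule norm_cauchy_schwarz)
  also have "\<dots> \<le> norm x * (norm x / \<omega>)" using u w by (intro mult_left_mono) (auto simp: field_simps)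
  also have "\<dots> = (1 / sqrt \<omega> * norm x)\<^sup>2" using w by (simp add: power2_eq_square)
  finally show ?thesis by (rule power2_le_imp_le) (use w in simp)
qed

lemma bounded_linear_op_inverse: "bounded_linear (op_inverse DS S)"
proof (rule bounded_linear_intro)
  let ?R = "op_inverse DS S"
  show "?R (x + y) = ?R x + ?R y" for x y
    using op_inverse_eq[of "?R x + ?R y"] sqrt_facts(1,2) op_inverse[of x] op_inverse[of y]
    unfolding linear_on_dom_def by (simp add: subspace_add)
  show "?R (r *\<^sub>R x) = r *\<^sub>R ?R x" for r x
    using op_inverse_eq[of "r *\<^sub>R ?R x"] sqrt_facts(1,2) op_inverse[of x]
    unfolding linear_on_dom_def by (simp add: subspace_scale)
  show "norm (?R x) \<le> norm x * (1 / sqrt \<omega>)" for x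
    using op_inverse_le[of x] by (simp add: mult.commute)
qed

lemma op_inverse_pow:
  "(op_inverse DS S ^^ k) x \<in> op_dom DS S k" "(S ^^ k) ((op_inverse DS S ^^ k) x) = x"
proof (induction k)
  case (Suc k)
  case 1
  show ?case using Suc by (simp add: op_inverse)
  case 2
  have "(S ^^ Suc k) ((op_inverse DS S ^^ Suc k) x) = (S ^^ k) (S (op_inverse DS S ((op_inverse DS S ^^ k) x)))"
    by (simp add: funpow_swap1)
  then show ?case using Suc by (simp add: op_inverse)
qed simp_all

end

section \<open>The K-functional and the interpolation norm\<close>

lemma Kfun_set_bounds:
  fixes nX nD :: "'b::real_vector \<Rightarrow> real"
  assumes "\<And>a. a \<in> X \<Longrightarrow> 0 \<le> nX a" "\<And>b. b \<in> DD \<Longrightarrow> 0 \<le> nD b" "t \<ge> 0"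
  shows "bdd_below {nX a + t * nD b | a b. x = a + b \<and> a \<in> X \<and> b \<in> DD}"
proof (rule bdd_belowI[of _ 0])
  fix r assume "r \<in> {nX a + t * nD b | a b. x = a + b \<and> a \<in> X \<and> b \<in> DD}"
  then obtain a b where "r = nX a + t * nD b" "a \<in> X" "b \<in> DD" by blast
  then show "0 \<le> r" using assms(1)[of a] assms(2)[of b] assms(3) by simp
qed

text \<open>The given decomposition ensures that the infimum is taken over a nonempty set, as
  conditional completeness demands.\<close>

lemma Kfun_greatest:
  assumes "x = a0 + b0" "a0 \<in> X" "b0 \<in> DD"
    and "\<And>a b. x = a + b \<Longrightarrow> a \<in> X \<Longrightarrow> b \<in> DD \<Longrightarrow> c \<le> nX a + t * nD b"
  shows "c \<le> Kfun X nX DD nD t x"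
  unfolding Kfun_def by (rule cInf_greatest) (use assms in blast)+

lemma Kfun_mono:
  assumes "\<And>a. a \<in> X \<Longrightarrow> 0 \<le> nX a" "\<And>b. b \<in> DD \<Longrightarrow> 0 \<le> nD b"
    and x: "x = a0 + b0" "a0 \<in> X" "b0 \<in> DD" and "0 \<le> s" "s \<le> t"
  shows "Kfun X nX DD nD s x \<le> Kfun X nX DD nD t x"
proof (rule Kfun_greatest[OF x])
  fix a b assume ab: "x = a + b" "a \<in> X" "b \<in> DD"
  have "Kfun X nX DD nD s x \<le> nX a + s * nD b"
    unfolding Kfun_def using ab by (intro cInf_lower Kfun_set_bounds assms) blast+
  also have "\<dots> \<le> nX a + t * nD b" using assms ab by (simp add: mult_right_mono)
  finally show "Kfun X nX DD nD s x \<le> nX a + t * nD b" .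
qed

text \<open>The integral is bounded below by its part over [s, 2s], where the K-functional is at
  least its value at \<open>s\<close> and the decreasing weight at least its value at
  \<open>2 * s\<close>.\<close>

lemma Kfun_le_interp_norm:
  assumes nn: "\<And>a. a \<in> X \<Longrightarrow> 0 \<le> nX a" "\<And>b. b \<in> DD \<Longrightarrow> 0 \<le> nD b"
    and x: "x = a0 + b0" "a0 \<in> X" "b0 \<in> DD" and xi: "x \<in> interp_space X nX DD nD \<theta>"
    and s: "s > 0" and th: "\<theta> > 0"
  shows "(Kfun X nX DD nD s x)\<^sup>2 \<le> 2 powr (2 * \<theta> + 1) * s powr (2 * \<theta>) * (interp_norm X nX DD nD \<theta> x)\<^sup>2"
proof -
  let ?K = "\<lambda>t. Kfun X nX DD nD t x" and ?I = "interp_integral X nX DD nD \<theta> x"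
  define c where "c = ((2 * s) powr (- \<theta> - 1 / 2) * ?K s)\<^sup>2"
  have K0: "?K s \<ge> 0" by (rule Kfun_greatest[OF x]) (use nn s in simp)
  have "ennreal c * ennreal s = (\<integral>\<^sup>+ t. ennreal c * indicator {s..2 * s} t \<partial>lborel)"
    using s by (simp add: nn_integral_cmult_indicator)
  also have "\<dots> \<le> ?I"
    unfolding interp_integral_def
  proof (rule nn_integral_mono)
    fix t
    show "ennreal c * indicator {s..2 * s} t
        \<le> ennreal ((t powr (- \<theta> - 1 / 2) * ?K t)\<^sup>2) * indicator {0<..} t"
    proof (cases "t \<in> {s..2 * s}")
      case True
      have "(2 * s) powr (- \<theta> - 1 / 2) \<le> t powr (- \<theta> - 1 / 2)"
        using True s th by (intro powr_mono2') auto
      moreover have "?K s \<le> ?K t" by (rule Kfun_mono[OF nn x]) (use True s in auto)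
      ultimately have "c \<le> (t powr (- \<theta> - 1 / 2) * ?K t)\<^sup>2"
        unfolding c_def using K0 by (intro power_mono mult_mono) auto
      then show ?thesis using True s by (simp add: ennreal_leI)
    qed simp
  qed
  finally have "ennreal (c * s) \<le> ?I" using s by (simp add: ennreal_mult c_def)
  \<comment> \<open>\<open>enn2real\<close> sends infinity to 0, so finiteness has to be known
    before passing to real numbers.\<close>
  moreover have "?I < \<infinity>" using xi by (simp add: interp_space_def)
  ultimately have "c * s \<le> enn2real ?I"
    using s enn2real_mono[of "ennreal (c * s)" ?I] by (simp add: c_def)
  also have "enn2real ?I = (interp_norm X nX DD nD \<theta> x)\<^sup>2" by (simp add: interp_norm_def)
  finally have le: "c * s \<le> (interp_norm X nX DD nD \<theta> x)\<^sup>2" .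
  have "c * s = (?K s)\<^sup>2 / (2 powr (2 * \<theta> + 1) * s powr (2 * \<theta>))"
  proof -
    have "c = (2 * s) powr (- (2 * \<theta> + 1)) * (?K s)\<^sup>2"
      unfolding c_def using s by (simp add: power_mult_distrib powr_power mult.commute)
    also have "(2 * s) powr (- (2 * \<theta> + 1)) = 1 / (2 powr (2 * \<theta> + 1) * (s powr (2 * \<theta>) * s))"
      using s by (simp only: powr_minus_divide powr_mult) (simp add: powr_add)
    finally show ?thesis using s by (simp add: field_simps)
  qed
  then have "(?K s)\<^sup>2 = 2 powr (2 * \<theta> + 1) * s powr (2 * \<theta>) * (c * s)" using s by simp
  also have "\<dots> \<le> 2 powr (2 * \<theta> + 1) * s powr (2 * \<theta>) * (interp_norm X nX DD nD \<theta> x)\<^sup>2"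
    using le by (rule mult_left_mono) simp
  finally show ?thesis .
qed

section \<open>Transfer to the energy space\<close>

lemma sum_squares_le_square_sum:
  fixes f :: "'b \<Rightarrow> real"
  assumes "\<And>i. i \<in> I \<Longrightarrow> 0 \<le> f i"
  shows "(\<Sum>i\<in>I. (f i)\<^sup>2) \<le> (\<Sum>i\<in>I. f i)\<^sup>2"
  using assms
proof (induction I rule: infinite_finite_induct)
  case (insert x F)
  then have "0 \<le> (\<Sum>i\<in>F. f i)" "0 \<le> f x" by (auto intro: sum_nonneg)
  then show ?case using insert by (simp add: power2_sum add_increasing2)
qed simp_all

locale coupled_waves =
  fixes D1 D2 DS1 DS2 :: "'a::{real_inner,complete_space} set"
    and A1 A2 S1 S2 B :: "'a \<Rightarrow> 'a"
    and \<omega>1 \<omega>2 \<beta> \<alpha> c :: real and j :: nat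
    and T :: "real \<Rightarrow> 'a state \<Rightarrow> 'a state"
  assumes A1_sa: "selfadjoint_op D1 A1" and A2_sa: "selfadjoint_op D2 A2"
    and \<omega>1_pos: "\<omega>1 > 0" and \<omega>2_pos: "\<omega>2 > 0"
    and A1_coerc: "\<forall>u\<in>D1. inner (A1 u) u \<ge> \<omega>1 * (norm u)\<^sup>2"
    and A2_coerc: "\<forall>u\<in>D2. inner (A2 u) u \<ge> \<omega>2 * (norm u)\<^sup>2"
    and S1_sqrt: "is_pos_sqrt D1 A1 DS1 S1" and S2_sqrt: "is_pos_sqrt D2 A2 DS2 S2"
    and B_bdd: "bounded_linear B"
    and \<beta>_pos: "\<beta> > 0" and B_coerc: "\<forall>u. inner (B u) u \<ge> \<beta> * (norm u)\<^sup>2"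
    and \<alpha>_bounds: "0 < \<bar>\<alpha>\<bar>" "\<bar>\<alpha>\<bar> < sqrt (\<omega>1 * \<omega>2)"
    and T_gen: "is_C0_semigroup_generated (Hspace DS1 DS2) (Hnorm S1 S2 \<alpha>) T
                  (calA_dom D1 DS1 D2 DS2) (calA A1 A2 B \<alpha>)"
    and j_ge: "j \<ge> 2"
    and dom_incl: "op_dom DS2 S2 j \<subseteq> D1"
    and A1_bound: "\<forall>u\<in>op_dom DS2 S2 j. norm (A1 u) \<le> c * norm ((S2 ^^ j) u)"
begin

definition "Ri1 = op_inverse DS1 S1"
definition "Ri2 = op_inverse DS2 S2"

lemmas Ri1 = op_inverse[OF A1_sa \<omega>1_pos A1_coerc S1_sqrt, folded Ri1_def]
lemmas Ri2 = op_inverse[OF A2_sa \<omega>2_pos A2_coerc S2_sqrt, folded Ri2_def]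
lemmas Ri1_eq = op_inverse_eq[OF A1_sa \<omega>1_pos A1_coerc S1_sqrt, folded Ri1_def]
lemmas Ri2_eq = op_inverse_eq[OF A2_sa \<omega>2_pos A2_coerc S2_sqrt, folded Ri2_def]
lemmas linear_Ri1 = bounded_linear_op_inverse[OF A1_sa \<omega>1_pos A1_coerc S1_sqrt, folded Ri1_def]
lemmas linear_Ri2 = bounded_linear_op_inverse[OF A2_sa \<omega>2_pos A2_coerc S2_sqrt, folded Ri2_def]
lemmas S1_facts = sqrt_facts[OF A1_sa \<omega>1_pos A1_coerc S1_sqrt]
lemmas S2_facts = sqrt_facts[OF A2_sa \<omega>2_pos A2_coerc S2_sqrt]

sublocale coupled_bounds Ri1 Ri2 B \<alpha> "1 / sqrt \<omega>1" "1 / sqrt \<omega>2"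
proof (rule coupled_bounds.intro)
  show "bounded_linear Ri1" "bounded_linear Ri2" "bounded_linear B"
    by (rule linear_Ri1 linear_Ri2 B_bdd)+
  show "0 < 1 / sqrt \<omega>1" "0 < 1 / sqrt \<omega>2" using \<omega>1_pos \<omega>2_pos by auto
  show "norm (Ri1 x) \<le> 1 / sqrt \<omega>1 * norm x" for x
    using op_inverse_le[OF A1_sa \<omega>1_pos A1_coerc S1_sqrt, of x] by (simp add: Ri1_def)
  show "norm (Ri2 x) \<le> 1 / sqrt \<omega>2 * norm x" for x
    using op_inverse_le[OF A2_sa \<omega>2_pos A2_coerc S2_sqrt, of x] by (simp add: Ri2_def)
  show "\<bar>\<alpha>\<bar> * (1 / sqrt \<omega>1 * (1 / sqrt \<omega>2)) < 1"
    using \<alpha>_bounds(2) \<omega>1_pos \<omega>2_pos by (simp add: real_sqrt_mult)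
qed

definition G :: "'a state \<Rightarrow> 'a state" where
  "G y = (THE x. inverse_rel Ri1 Ri2 B \<alpha> x y)"

lemma G_iff_rel: "x = G y \<longleftrightarrow> inverse_rel Ri1 Ri2 B \<alpha> x y"
  unfolding G_def using theI'[OF ex1_inverse_rel[of y]] ex1_inverse_rel[of y] by blast

sublocale coupled_system Ri1 Ri2 B \<alpha> "1 / sqrt \<omega>1" "1 / sqrt \<omega>2" G
  by unfold_locales (rule G_iff_rel)

text \<open>This is A1 A2^(-j/2); the domain inclusion puts every argument of \<open>A1\<close> into
  its domain.\<close>

definition K where "K x = A1 ((Ri2 ^^ j) x)"

lemma Ri2_pow: "(Ri2 ^^ k) x \<in> op_dom DS2 S2 k" "(S2 ^^ k) ((Ri2 ^^ k) x) = x"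
  unfolding Ri2_def by (rule op_inverse_pow[OF A2_sa \<omega>2_pos A2_coerc S2_sqrt])+

lemma Ri2_pow_in_D1: "(Ri2 ^^ j) x \<in> D1"
  using Ri2_pow(1) dom_incl by blast

lemma bounded_linear_K: "bounded_linear K"
proof (rule bounded_linear_intro)
  interpret Rj: bounded_linear "Ri2 ^^ j" by (rule bounded_linear_funpow[OF linear_Ri2])
  have lin: "\<And>x y. x \<in> D1 \<Longrightarrow> y \<in> D1 \<Longrightarrow> A1 (x + y) = A1 x + A1 y" "\<And>r x. x \<in> D1 \<Longrightarrow> A1 (r *\<^sub>R x) = r *\<^sub>R A1 x"
    using A1_sa unfolding selfadjoint_op_def linear_on_dom_def by blast+
  show "K (x + y) = K x + K y" for x y
    by (simp add: K_def Rj.add lin Ri2_pow_in_D1)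
  show "K (r *\<^sub>R x) = r *\<^sub>R K x" for r x
    by (simp add: K_def Rj.scaleR lin Ri2_pow_in_D1)
  show "norm (K x) \<le> norm x * c" for x
    using bspec[OF A1_bound Ri2_pow(1)[of j x]] by (simp add: K_def Ri2_pow(2) mult.commute)
qed

lemma Ri1_Ri1_K: "(Ri2 ^^ j) x = Ri1 (Ri1 (K x))"
proof -
  have u: "(Ri2 ^^ j) x \<in> D1" by (rule Ri2_pow_in_D1)
  then have "K x = S1 (S1 ((Ri2 ^^ j) x))" by (simp add: K_def S1_facts(5))
  then show ?thesis using u by (simp add: Ri1_eq S1_facts(4))
qed

section \<open>Change of variables between the energy space and the product space\<close>

abbreviation "H \<equiv> Hspace DS1 DS2"
abbreviation "nrm \<equiv> Hnorm S1 S2 \<alpha>"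
abbreviation "DA \<equiv> calA_dom D1 DS1 D2 DS2"
abbreviation "\<A> \<equiv> calA A1 A2 B \<alpha>"

definition of_state :: "'a state \<Rightarrow> 'a state" where
  "of_state x = (Ri1 (a_of x), p_of x, Ri2 (b_of x), q_of x)"

text \<open>Inverts \<open>of_state\<close> from the left everywhere, but from the right on
  \<open>H\<close> only, as nothing is known about \<open>S1\<close> and \<open>S2\<close> outside
  their domains.\<close>

definition to_state :: "'a state \<Rightarrow> 'a state" where
  "to_state U = (S1 (a_of U), p_of U, S2 (b_of U), q_of U)"

lemma of_state_in_H: "of_state x \<in> H"
  by (simp add: of_state_def Hspace_def Ri1 Ri2)

lemma to_of_state: "to_state (of_state x) = x"
  by (simp add: of_state_def to_state_def Ri1 Ri2)

lemma of_to_state: "U \<in> H \<Longrightarrow> of_state (to_state U) = U"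
  by (cases U) (simp add: of_state_def to_state_def Hspace_def Ri1_eq Ri2_eq)

lemma linear_of_state:
  "of_state (x + y) = of_state x + of_state y" "of_state (x - y) = of_state x - of_state y"
  "of_state (r *\<^sub>R x) = r *\<^sub>R of_state x" "of_state 0 = 0"
  by (simp_all add: of_state_def R1.add R2.add R1.diff R2.diff R1.scaleR R2.scaleR R1.zero R2.zero zero_prod_def)

lemma to_state_unique: "of_state x = U \<Longrightarrow> to_state U = x"
  using to_of_state by blast

lemma nrm_of_state: "nrm (of_state x) = sqrt (E x)"
  by (cases x) (simp add: Hnorm_def Hinner_def of_state_def E_def norm_state power2_norm_eq_inner Ri1 Ri2 inner_commute)

lemma nrm_square: "(nrm (of_state x))\<^sup>2 = E x"
  by (simp add: nrm_of_state E_nonneg)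

lemma nrm_nonneg: "U \<in> H \<Longrightarrow> 0 \<le> nrm U"
  using nrm_of_state[of "to_state U"] E_nonneg[of "to_state U"] by (simp add: of_to_state)

lemma norm_le_nrm: "norm x \<le> nrm (of_state x) / sqrt (1 - \<rho>)"
proof -
  have "sqrt ((1 - \<rho>) * (norm x)\<^sup>2) \<le> sqrt (E x)" using E_ge by (rule real_sqrt_le_mono)
  then have "norm x * sqrt (1 - \<rho>) \<le> nrm (of_state x)"
    by (simp only: real_sqrt_mult real_sqrt_abs abs_norm_cancel nrm_of_state mult.commute)
  then show ?thesis using rho_bounds by (simp add: pos_le_divide_eq)
qed

lemma nrm_le_norm: "nrm (of_state x) \<le> 2 * norm x"
proof -
  have "E x \<le> (2 * norm x)\<^sup>2"
    using E_le[of x] by (rule order_trans) (simp add: power_mult_distrib)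
  then show ?thesis unfolding nrm_of_state by (intro real_le_lsqrt) auto
qed

lemma tendsto_norm_iff_nrm:
  "((\<lambda>h. norm (f h)) \<longlongrightarrow> 0) F \<longleftrightarrow> ((\<lambda>h. nrm (of_state (f h))) \<longlongrightarrow> 0) F"
proof
  assume "((\<lambda>h. norm (f h)) \<longlongrightarrow> 0) F"
  then have "((\<lambda>h. 2 * norm (f h)) \<longlongrightarrow> 0) F" by (rule tendsto_mult_right_zero)
  then show "((\<lambda>h. nrm (of_state (f h))) \<longlongrightarrow> 0) F"
    by (rule Lim_null_comparison[rotated])
       (use nrm_le_norm nrm_nonneg[OF of_state_in_H] in \<open>auto intro!: always_eventually\<close>)
next
  assume "((\<lambda>h. nrm (of_state (f h))) \<longlongrightarrow> 0) F"
  then have "((\<lambda>h. nrm (of_state (f h)) / sqrt (1 - \<rho>)) \<longlongrightarrow> 0) F" by (rule tendsto_divide_zero)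
  then show "((\<lambda>h. norm (f h)) \<longlongrightarrow> 0) F"
    by (rule Lim_null_comparison[rotated]) (use norm_le_nrm in \<open>auto intro!: always_eventually\<close>)
qed

text \<open>The domain condition need not be carried along: \<open>a = - Ri1 w\<close> already says
  that \<open>a\<close> lies in \<open>DS1\<close> and \<open>- S1 a = w\<close>, and likewise for
  \<open>Ri2\<close>.\<close>

lemma calA_of_state_iff:
  "of_state x \<in> DA \<and> \<A> (of_state x) = of_state y \<longleftrightarrow> inverse_rel Ri1 Ri2 B \<alpha> x y"
proof -
  have D1_iff: "Ri1 a \<in> D1 \<longleftrightarrow> a \<in> DS1" and D2_iff: "Ri2 a \<in> D2 \<longleftrightarrow> a \<in> DS2" for a
    by (simp_all add: S1_facts(4) S2_facts(4) Ri1 Ri2)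
  have A1_Ri1: "A1 (Ri1 a) = S1 a" if "a \<in> DS1" for a
    using S1_facts(5)[of "Ri1 a"] that by (simp add: D1_iff Ri1)
  have A2_Ri2: "A2 (Ri2 a) = S2 a" if "a \<in> DS2" for a
    using S2_facts(5)[of "Ri2 a"] that by (simp add: D2_iff Ri2)
  have solve1: "a = - Ri1 w \<longleftrightarrow> a \<in> DS1 \<and> - S1 a = w" for a w
    using Ri1(1)[of "- w"] Ri1(2)[of "- w"] Ri1_eq[of a] by (auto simp: R1.neg)
  have solve2: "a = - Ri2 w \<longleftrightarrow> a \<in> DS2 \<and> - S2 a = w" for a w
    using Ri2(1)[of "- w"] Ri2(2)[of "- w"] Ri2_eq[of a] by (auto simp: R2.neg)
  obtain a p b q where x: "x = (a, p, b, q)" by (cases x)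
  obtain f g h k where y: "y = (f, g, h, k)" by (cases y)
  have "inverse_rel Ri1 Ri2 B \<alpha> x y \<longleftrightarrow> p = Ri1 f \<and> q = Ri2 h
      \<and> a \<in> DS1 \<and> - S1 a - B p - \<alpha> *\<^sub>R Ri2 b = g \<and> b \<in> DS2 \<and> - S2 b - \<alpha> *\<^sub>R Ri1 a = k"
    unfolding inverse_rel_def x y solve1 solve2 by (auto simp: algebra_simps)
  moreover have "of_state x \<in> DA \<and> \<A> (of_state x) = of_state y \<longleftrightarrow> p = Ri1 f \<and> q = Ri2 h
      \<and> a \<in> DS1 \<and> - S1 a - B p - \<alpha> *\<^sub>R Ri2 b = g \<and> b \<in> DS2 \<and> - S2 b - \<alpha> *\<^sub>R Ri1 a = k"
    unfolding x y of_state_def calA_dom_def calA_def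
    by (auto simp: D1_iff D2_iff A1_Ri1 A2_Ri2 Ri1 Ri2)
  ultimately show ?thesis by blast
qed

lemma DA_subset: "DA \<subseteq> H"
  using T_gen by (simp add: is_C0_semigroup_generated_def)

lemma calA_in_H: "U \<in> DA \<Longrightarrow> \<A> U \<in> H"
  using T_gen by (simp add: is_C0_semigroup_generated_def)

lemma DA_eq_G:
  assumes "U \<in> DA"
  shows "U = of_state (G (to_state (\<A> U)))"
proof -
  have U: "of_state (to_state U) = U" using assms DA_subset by (intro of_to_state) auto
  have "inverse_rel Ri1 Ri2 B \<alpha> (to_state U) (to_state (\<A> U))"
    using assms by (simp add: calA_of_state_iff[symmetric] U of_to_state calA_in_H)
  then show ?thesis using U by (simp add: G_iff_rel[symmetric])
qed

lemma G_in_DA: "of_state (G y) \<in> DA" "\<A> (of_state (G y)) = of_state y"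
  using calA_of_state_iff[of "G y" y] G_iff_rel[of "G y" y] by auto

definition flow :: "real \<Rightarrow> 'a state \<Rightarrow> 'a state" where
  "flow t x = to_state (T t (of_state x))"

lemma of_state_flow: "t \<ge> 0 \<Longrightarrow> of_state (flow t x) = T t (of_state x)"
  unfolding flow_def using T_gen of_state_in_H
  by (intro of_to_state) (simp add: is_C0_semigroup_generated_def)

lemma semigroup_flow: "c0_semigroup flow G"
proof (rule c0_semigroup.intro)
  fix t :: real assume t: "t \<ge> 0"
  have add: "flow t (x + y) = flow t x + flow t y" for x y
    unfolding flow_def[of t "x + y"]
    by (rule to_state_unique)
       (use T_gen t in \<open>simp add: linear_of_state of_state_flow is_C0_semigroup_generated_def of_state_in_H\<close>)
  have scaleR: "flow t (r *\<^sub>R x) = r *\<^sub>R flow t x" for r x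
    unfolding flow_def[of t "r *\<^sub>R x"]
    by (rule to_state_unique)
       (use T_gen t in \<open>simp add: linear_of_state of_state_flow is_C0_semigroup_generated_def of_state_in_H\<close>)
  have "\<exists>M. \<forall>U\<in>H. nrm (T t U) \<le> M * nrm U"
    using T_gen t by (simp add: is_C0_semigroup_generated_def)
  then obtain M where M: "\<And>U. U \<in> H \<Longrightarrow> nrm (T t U) \<le> M * nrm U" by blast
  have "norm (flow t x) \<le> norm x * (\<bar>M\<bar> * 2 / sqrt (1 - \<rho>))" for x
  proof -
    have "norm (flow t x) \<le> nrm (T t (of_state x)) / sqrt (1 - \<rho>)"
      using norm_le_nrm[of "flow t x"] t by (simp add: of_state_flow)
    also have "nrm (T t (of_state x)) \<le> M * nrm (of_state x)" by (rule M[OF of_state_in_H])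
    also have "M * nrm (of_state x) \<le> \<bar>M\<bar> * (2 * norm x)"
      by (intro mult_mono nrm_le_norm nrm_nonneg of_state_in_H) auto
    finally show ?thesis using rho_bounds by (simp add: divide_right_mono mult_ac)
  qed
  then show "bounded_linear (flow t)" by (intro bounded_linear_intro add scaleR)
next
  show "flow 0 x = x" for x
    unfolding flow_def
    using T_gen of_state_in_H by (simp add: is_C0_semigroup_generated_def to_of_state)
next
  fix t s :: real and x assume "t \<ge> 0" "s \<ge> 0"
  then have "T (t + s) (of_state x) = T t (T s (of_state x))"
    using T_gen of_state_in_H[of x] unfolding is_C0_semigroup_generated_def by blast
  then show "flow (t + s) x = flow t (flow s x)"
    using \<open>s \<ge> 0\<close> unfolding flow_def[of "t + s"] flow_def[of t] by (simp add: of_state_flow)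
next
  fix x
  have "((\<lambda>t. nrm (T t (of_state x) - of_state x)) \<longlongrightarrow> 0) (at_right 0)"
    using T_gen of_state_in_H[of x] unfolding is_C0_semigroup_generated_def by blast
  then have "((\<lambda>t. nrm (of_state (flow t x - x))) \<longlongrightarrow> 0) (at_right 0)"
    by (rule Lim_transform_eventually)
       (auto simp: eventually_at_right_field linear_of_state of_state_flow intro!: exI[of _ 1])
  then show "((\<lambda>t. norm (flow t x - x)) \<longlongrightarrow> 0) (at_right 0)"
    by (simp add: tendsto_norm_iff_nrm)
next
  fix x y
  have transfer: "((\<lambda>h. norm ((1 / h) *\<^sub>R (flow h x - x) - w)) \<longlongrightarrow> 0) (at_right 0)
      \<longleftrightarrow> ((\<lambda>h. nrm ((1 / h) *\<^sub>R (T h (of_state x) - of_state x) - of_state w)) \<longlongrightarrow> 0) (at_right 0)" for w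
    unfolding tendsto_norm_iff_nrm
    by (rule tendsto_cong)
       (auto simp: eventually_at_right_field linear_of_state of_state_flow intro!: exI[of _ 1])
  have gen: "of_state x \<in> DA \<longleftrightarrow>
      (\<exists>V\<in>H. ((\<lambda>h. nrm ((1 / h) *\<^sub>R (T h (of_state x) - of_state x) - V)) \<longlongrightarrow> 0) (at_right 0))"
    using T_gen of_state_in_H[of x] unfolding is_C0_semigroup_generated_def by blast
  have lim: "((\<lambda>h. nrm ((1 / h) *\<^sub>R (T h (of_state x) - of_state x) - \<A> (of_state x))) \<longlongrightarrow> 0) (at_right 0)"
    if "of_state x \<in> DA"
    using T_gen that unfolding is_C0_semigroup_generated_def by blast
  show "((\<lambda>h. norm ((1 / h) *\<^sub>R (flow h x - x) - y)) \<longlongrightarrow> 0) (at_right 0) \<longleftrightarrow> x = G y"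
  proof
    assume l: "((\<lambda>h. norm ((1 / h) *\<^sub>R (flow h x - x) - y)) \<longlongrightarrow> 0) (at_right 0)"
    then have xD: "of_state x \<in> DA" unfolding gen transfer using of_state_in_H by blast
    define w where "w = to_state (\<A> (of_state x))"
    have w: "of_state w = \<A> (of_state x)" unfolding w_def by (intro of_to_state calA_in_H xD)
    have l': "((\<lambda>h. norm ((1 / h) *\<^sub>R (flow h x - x) - w)) \<longlongrightarrow> 0) (at_right 0)"
      unfolding transfer w by (rule lim[OF xD])
    \<comment> \<open>The given limit is \<open>y\<close>, while the semigroup hypotheses provide
      the generator value \<open>w\<close>; uniqueness of limits identifies the two.\<close>
    have "((\<lambda>h. (1 / h) *\<^sub>R (flow h x - x)) \<longlongrightarrow> y) (at_right 0)"
      "((\<lambda>h. (1 / h) *\<^sub>R (flow h x - x)) \<longlongrightarrow> w) (at_right 0)"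
      using l l' by (auto simp: tendsto_norm_zero_iff LIM_zero_iff)
    then have "y = w" by (intro tendsto_unique[of "at_right 0"]) auto
    then show "x = G y" using xD w by (simp add: G_iff_rel calA_of_state_iff[symmetric])
  next
    assume "x = G y"
    then show "((\<lambda>h. norm ((1 / h) *\<^sub>R (flow h x - x) - y)) \<longlongrightarrow> 0) (at_right 0)"
      unfolding transfer using lim G_in_DA[of y] by simp
  qed
qed

text \<open>In the new coordinates the domain of the generator contains
  \<open>DS1 \<times> DS1 \<times> DS2 \<times> DS2\<close>, which is dense since the square roots
  are self-adjoint.\<close>

lemma dense_range_G: "closure (range G) = UNIV"
proof -
  have DS: "closure DS1 = UNIV" "closure DS2 = UNIV"
    using S1_sqrt S2_sqrt unfolding is_pos_sqrt_def selfadjoint_op_def by blast+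
  have "DS1 \<times> DS1 \<times> DS2 \<times> DS2 \<subseteq> range G"
  proof
    fix x assume "x \<in> DS1 \<times> DS1 \<times> DS2 \<times> DS2"
    then have "of_state x \<in> DA"
      by (auto simp: of_state_def calA_dom_def S1_facts(4) S2_facts(4) Ri1 Ri2)
    then have "of_state x = of_state (G (to_state (\<A> (of_state x))))" by (rule DA_eq_G)
    then show "x \<in> range G" by (metis rangeI to_of_state)
  qed
  then have "closure (DS1 \<times> DS1 \<times> DS2 \<times> DS2) \<subseteq> closure (range G)" by (rule closure_mono)
  then show ?thesis by (auto simp: closure_Times DS)
qed

sublocale coupled_semigroup_dense Ri1 Ri2 B \<alpha> "1 / sqrt \<omega>1" "1 / sqrt \<omega>2" G flow K \<beta> j
proof (intro coupled_semigroup_dense.intro coupled_semigroup.intro coupled_semigroup_axioms.intro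
    coupled_semigroup_dense_axioms.intro semigroup_flow coupled_system_axioms)
  show "inner (Ri1 x) y = inner x (Ri1 y)" for x y
    unfolding Ri1_def by (rule op_inverse_symmetric[OF A1_sa \<omega>1_pos A1_coerc S1_sqrt])
  show "inner (Ri2 x) y = inner x (Ri2 y)" for x y
    unfolding Ri2_def by (rule op_inverse_symmetric[OF A2_sa \<omega>2_pos A2_coerc S2_sqrt])
  show "bounded_linear K" by (rule bounded_linear_K)
qed (use Ri1_Ri1_K B_coerc \<beta>_pos \<alpha>_bounds j_ge dense_range_G in auto)

abbreviation "Dk k \<equiv> gen_dom H DA \<A> k"

text \<open>One \<open>w\<close> serves all powers at once, so the squared terms of the graph norm
  are the energies of \<open>(G ^^ m) w\<close> in reversed order.\<close>

lemma gen_dom_eq_G_pow: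
  "U \<in> Dk k \<Longrightarrow> \<exists>w. \<forall>i\<le>k. (\<A> ^^ i) U = of_state ((G ^^ (k - i)) w)"
proof (induction k arbitrary: U)
  case 0
  then show ?case by (intro exI[of _ "to_state U"]) (simp add: of_to_state)
next
  case (Suc k)
  then have U: "U \<in> DA" "\<A> U \<in> Dk k" by auto
  then obtain w where w: "\<And>i. i \<le> k \<Longrightarrow> (\<A> ^^ i) (\<A> U) = of_state ((G ^^ (k - i)) w)"
    using Suc.IH by blast
  have "(\<A> ^^ i) U = of_state ((G ^^ (Suc k - i)) w)" if "i \<le> Suc k" for i
  proof (cases i)
    case 0
    then show ?thesis using DA_eq_G[OF U(1)] w[of 0] by (simp add: to_of_state)
  next
    case (Suc i')
    then show ?thesis using w[of i'] that by (simp add: funpow_swap1)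
  qed
  then show ?case by blast
qed

lemma zero_in_gen_dom: "0 \<in> Dk k"
proof (induction k)
  case 0
  show ?case using of_state_in_H[of 0] by (simp add: linear_of_state)
next
  case (Suc k)
  have "G 0 = 0" using bounded_linear_G by (rule linear_simps)
  then show ?case using G_in_DA[of 0] Suc by (simp add: linear_of_state)
qed

abbreviation "gnorm k \<equiv> graph_norm nrm \<A> k"

lemma graph_norm_nonneg: "b \<in> Dk k \<Longrightarrow> 0 \<le> gnorm k b"
  using gen_dom_eq_G_pow[of b k] unfolding graph_norm_def
  by (auto intro!: sum_nonneg simp: nrm_nonneg of_state_in_H)

text \<open>\<open>E\<close> is a nonnegative quadratic form, so the parallelogram law holds and
  \<open>E (x - y)\<close> may be dropped.\<close>

lemma E_add_le: "E (x + y) \<le> 2 * E x + 2 * E y"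
proof -
  have "E (x + y) + E (x - y) = 2 * E x + 2 * E y"
    using parallelogram_law[of x y]
    by (simp add: E_def R1.add R1.diff R2.add R2.diff inner_simps algebra_simps)
  then show ?thesis using E_nonneg[of "x - y"] by linarith
qed

text \<open>Contractivity handles \<open>a\<close> and the iterated decay handles \<open>b\<close>.
  The right side squares the sum so that the bracket is exactly a competitor in the
  K-functional.\<close>

lemma nrm_T_le:
  "\<exists>C>0. \<forall>t>0. \<forall>a\<in>H. \<forall>b\<in>Dk (n * j).
     (nrm (T t (a + b)))\<^sup>2 \<le> C * (nrm a + t powr (- real n / 2) * gnorm (n * j) b)\<^sup>2"
proof -
  obtain C where C: "C \<ge> 0"
    "\<And>t w. t > 0 \<Longrightarrow> t ^ n * E (flow t ((G ^^ (n * j)) w)) \<le> C * (\<Sum>m\<le>n * j. E ((G ^^ m) w))"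
    using energy_decay by blast
  have "(nrm (T t (a + b)))\<^sup>2 \<le> 2 * (1 + C) * (nrm a + t powr (- real n / 2) * gnorm (n * j) b)\<^sup>2"
    if t: "t > 0" and a: "a \<in> H" and b: "b \<in> Dk (n * j)" for t a b
  proof -
    obtain w where w: "\<And>i. i \<le> n * j \<Longrightarrow> (\<A> ^^ i) b = of_state ((G ^^ (n * j - i)) w)"
      using gen_dom_eq_G_pow[OF b] by blast
    let ?x = "to_state a" and ?y = "(G ^^ (n * j)) w" and ?s = "t powr (- real n / 2)"
    have ab: "a = of_state ?x" "b = of_state ?y" using w[of 0] a by (simp_all add: of_to_state)
    have "?s\<^sup>2 = t powr (- real n)" unfolding power2_eq_square powr_add[symmetric] by simp
    moreover have "t ^ n = t powr real n" using t by (simp add: powr_realpow)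
    ultimately have s2: "?s\<^sup>2 * t ^ n = 1" using t by (simp only: powr_add[symmetric]) simp
    have "(\<Sum>m\<le>n * j. E ((G ^^ m) w)) = (\<Sum>i\<le>n * j. E ((G ^^ (n * j - i)) w))"
      using sum.atLeastAtMost_rev[of "\<lambda>m. E ((G ^^ m) w)" 0 "n * j"] by (simp add: atMost_atLeast0)
    also have "\<dots> = (\<Sum>i\<le>n * j. (nrm ((\<A> ^^ i) b))\<^sup>2)"
      by (rule sum.cong) (simp_all add: w nrm_square)
    also have "\<dots> \<le> (gnorm (n * j) b)\<^sup>2"
      unfolding graph_norm_def by (rule sum_squares_le_square_sum) (auto simp: w nrm_nonneg of_state_in_H)
    finally have g: "(\<Sum>m\<le>n * j. E ((G ^^ m) w)) \<le> (gnorm (n * j) b)\<^sup>2" .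
    have "E (flow t ?y) = ?s\<^sup>2 * (t ^ n * E (flow t ?y))" using s2 by (simp add: mult.assoc[symmetric])
    also have "\<dots> \<le> ?s\<^sup>2 * (C * (gnorm (n * j) b)\<^sup>2)"
      using C(2)[OF t, of w] mult_left_mono[OF g C(1)] by (intro mult_left_mono) auto
    finally have Ey: "E (flow t ?y) \<le> C * (?s * gnorm (n * j) b)\<^sup>2" by (simp add: power_mult_distrib mult_ac)
    have Ex: "E (flow t ?x) \<le> (nrm a)\<^sup>2"
      using E_contraction[of t ?x] t nrm_square[of ?x] ab(1) by simp
    have mix: "2 * r + 2 * r' \<le> 2 * (1 + C) * (x + y)" if "r \<le> x" "r' \<le> C * y" "0 \<le> x" "0 \<le> y" for r r' x y
      using that mult_nonneg_nonneg[OF C(1), of x] by (simp add: algebra_simps)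
    interpret flow: bounded_linear "flow t" using t by (intro bounded_linear_T) simp
    have "(nrm (T t (a + b)))\<^sup>2 = E (flow t (?x + ?y))"
      using t by (subst ab(1), subst ab(2))
        (simp only: linear_of_state(1)[symmetric] of_state_flow[symmetric] nrm_square less_imp_le)
    also have "\<dots> \<le> 2 * E (flow t ?x) + 2 * E (flow t ?y)" by (simp add: flow.add E_add_le)
    also have "\<dots> \<le> 2 * (1 + C) * ((nrm a)\<^sup>2 + (?s * gnorm (n * j) b)\<^sup>2)"
      by (rule mix[OF Ex Ey]) auto
    also have "(nrm a)\<^sup>2 + (?s * gnorm (n * j) b)\<^sup>2 \<le> (nrm a + ?s * gnorm (n * j) b)\<^sup>2"
      using nrm_nonneg[OF a] graph_norm_nonneg[OF b] by (simp add: power2_sum)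
    finally show ?thesis using C(1) by simp
  qed
  then show ?thesis using C(1) by (intro exI[of _ "2 * (1 + C)"]) auto
qed

lemma interpolated_decay:
  assumes th: "0 < \<theta>"
  shows "\<exists>C>0. \<forall>U0 \<in> interp_space H nrm (Dk (n * j)) (gnorm (n * j)) \<theta>. \<forall>t>0.
    (nrm (T t U0))\<^sup>2 \<le> C / t powr (real n * \<theta>) * (interp_norm H nrm (Dk (n * j)) (gnorm (n * j)) \<theta> U0)\<^sup>2"
proof -
  obtain C where C: "C > 0" "\<And>t a b. t > 0 \<Longrightarrow> a \<in> H \<Longrightarrow> b \<in> Dk (n * j) \<Longrightarrow>
     (nrm (T t (a + b)))\<^sup>2 \<le> C * (nrm a + t powr (- real n / 2) * gnorm (n * j) b)\<^sup>2"
    using nrm_T_le by blast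
  have "(nrm (T t U0))\<^sup>2 \<le> (C * 2 powr (2 * \<theta> + 1)) / t powr (real n * \<theta>)
      * (interp_norm H nrm (Dk (n * j)) (gnorm (n * j)) \<theta> U0)\<^sup>2"
    if U0: "U0 \<in> interp_space H nrm (Dk (n * j)) (gnorm (n * j)) \<theta>" and t: "t > 0" for U0 t
  proof -
    let ?s = "t powr (- real n / 2)" and ?K = "\<lambda>s. Kfun H nrm (Dk (n * j)) (gnorm (n * j)) s U0"
    have dec: "U0 = U0 + 0" "U0 \<in> H" "0 \<in> Dk (n * j)"
      using U0 zero_in_gen_dom by (auto simp: interp_space_def)
    have "T t U0 \<in> H" using T_gen dec(2) t by (simp add: is_C0_semigroup_generated_def)
    then have nn: "0 \<le> nrm (T t U0)" by (rule nrm_nonneg)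
    \<comment> \<open>Dividing by \<open>sqrt C\<close> makes the left side a lower bound for every
      competitor, hence for their infimum.\<close>
    have "nrm (T t U0) / sqrt C \<le> ?K ?s"
    proof (rule Kfun_greatest[OF dec])
      fix a b assume ab: "U0 = a + b" "a \<in> H" "b \<in> Dk (n * j)"
      have "nrm (T t U0) \<le> sqrt (C * (nrm a + ?s * gnorm (n * j) b)\<^sup>2)"
        using C(2)[OF t ab(2,3)] by (intro real_le_rsqrt) (simp add: ab(1))
      also have "\<dots> = sqrt C * (nrm a + ?s * gnorm (n * j) b)"
        using nrm_nonneg[OF ab(2)] graph_norm_nonneg[OF ab(3)] by (simp add: real_sqrt_mult)
      finally show "nrm (T t U0) / sqrt C \<le> nrm a + ?s * gnorm (n * j) b"
        using C(1) by (simp add: field_simps)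
    qed
    then have "(nrm (T t U0) / sqrt C)\<^sup>2 \<le> (?K ?s)\<^sup>2" using nn C(1) by (intro power_mono) auto
    then have "(nrm (T t U0))\<^sup>2 \<le> C * (?K ?s)\<^sup>2" using C(1) by (simp add: power_divide field_simps)
    also have "(?K ?s)\<^sup>2 \<le> 2 powr (2 * \<theta> + 1) * ?s powr (2 * \<theta>)
        * (interp_norm H nrm (Dk (n * j)) (gnorm (n * j)) \<theta> U0)\<^sup>2"
      by (rule Kfun_le_interp_norm[OF nrm_nonneg graph_norm_nonneg dec U0]) (use t th in auto)
    also have "?s powr (2 * \<theta>) = 1 / t powr (real n * \<theta>)"
      using t by (simp add: powr_powr powr_minus_divide[symmetric])
    finally show ?thesis using C(1) by (simp add: mult_ac)
  qed
  then show ?thesis using C(1) by (intro exI[of _ "C * 2 powr (2 * \<theta> + 1)"]) auto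
qed

end

theorem theorem6p1:
  fixes D1 D2 DS1 DS2 :: "'a::{real_inner,complete_space} set"
    and A1 A2 S1 S2 B :: "'a \<Rightarrow> 'a"
    and \<omega>1 \<omega>2 \<beta> \<alpha> c :: real and j :: nat
    and T :: "real \<Rightarrow> 'a state \<Rightarrow> 'a state"
  assumes A1_sa: "selfadjoint_op D1 A1" and A2_sa: "selfadjoint_op D2 A2"
    and \<omega>1_pos: "\<omega>1 > 0" and \<omega>2_pos: "\<omega>2 > 0"
    and A1_coerc: "\<forall>u\<in>D1. inner (A1 u) u \<ge> \<omega>1 * (norm u)\<^sup>2"
    and A2_coerc: "\<forall>u\<in>D2. inner (A2 u) u \<ge> \<omega>2 * (norm u)\<^sup>2"
    and S1_sqrt: "is_pos_sqrt D1 A1 DS1 S1" and S2_sqrt: "is_pos_sqrt D2 A2 DS2 S2"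
    and B_bdd: "bounded_linear B" and B_sym: "\<forall>x y. inner (B x) y = inner x (B y)"
    and \<beta>_pos: "\<beta> > 0" and B_coerc: "\<forall>u. inner (B u) u \<ge> \<beta> * (norm u)\<^sup>2"
    and \<alpha>_bounds: "0 < \<bar>\<alpha>\<bar>" "\<bar>\<alpha>\<bar> < sqrt (\<omega>1 * \<omega>2)"
    and T_gen: "is_C0_semigroup_generated (Hspace DS1 DS2) (Hnorm S1 S2 \<alpha>) T
                  (calA_dom D1 DS1 D2 DS2) (calA A1 A2 B \<alpha>)"
    and j_ge: "j \<ge> 2"
    and c_pos: "c > 0"
    and dom_incl: "op_dom DS2 S2 j \<subseteq> D1"
    and A1_bound: "\<forall>u\<in>op_dom DS2 S2 j. norm (A1 u) \<le> c * norm ((S2 ^^ j) u)"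
  shows "\<forall>\<theta> n. 0 < \<theta> \<and> \<theta> < 1 \<and> n \<ge> (1::nat) \<longrightarrow>
    (\<exists>C>0. \<forall>U0 \<in> interp_space (Hspace DS1 DS2) (Hnorm S1 S2 \<alpha>)
                 (gen_dom (Hspace DS1 DS2) (calA_dom D1 DS1 D2 DS2) (calA A1 A2 B \<alpha>) (n * j))
                 (graph_norm (Hnorm S1 S2 \<alpha>) (calA A1 A2 B \<alpha>) (n * j)) \<theta>.
       \<forall>t>0. (Hnorm S1 S2 \<alpha> (T t U0))\<^sup>2 \<le>
          C / t powr (real n * \<theta>) *
          (interp_norm (Hspace DS1 DS2) (Hnorm S1 S2 \<alpha>)
                 (gen_dom (Hspace DS1 DS2) (calA_dom D1 DS1 D2 DS2) (calA A1 A2 B \<alpha>) (n * j))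
                 (graph_norm (Hnorm S1 S2 \<alpha>) (calA A1 A2 B \<alpha>) (n * j)) \<theta> U0)\<^sup>2)"
proof -
  interpret coupled_waves D1 D2 DS1 DS2 A1 A2 S1 S2 B \<omega>1 \<omega>2 \<beta> \<alpha> c j T
    by (rule coupled_waves.intro) (fact assms)+
  show ?thesis using interpolated_decay by blast
qed

end
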